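(* Consider primes $p\to\infty$ together with divisors $m\mid p-1$ such that $d=(p-1)/m$ is odd and $\varphi(d)=o(\log p)$ as $p\to\infty$. Then for any constant $c<1/4$, \[ M_4(p,m)=\sum_{n=1}^{\infty}\frac{\tau(n)^2}{n^2}+O\big(p^{-c/\varphi(d)}\big),\qquad p\to\infty. \]
   Context: $\mathcal{G}_m$ is the unique subgroup of $\mathbb{F}_p^*$ of index $m$; $\mathcal{X}_{p,m}$ is the group of multiplicative characters of $\mathbb{F}_p^*$ trivial on $\mathcal{G}_m$, $\mathcal{X}_{p,m}^-=\{\chi\in\mathcal{X}_{p,m}:\chi(-1)=-1\}$, $L(1,\chi)=\sum_{n\ge1}\chi(n)/n$, and $M_\nu(p,m)=\frac{2}{m}\sum_{\chi\in\mathcal{X}_{p,m}^-}|L(1,\chi)|^\nu$. $\tau(n)$ is the number of positive divisors of $n$, $\varphi$ is Euler's totient function. *)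

theory Defs
  imports
    "HOL-Number_Theory.Number_Theory"
    "HOL-Library.Landau_Symbols"
begin

text \<open>The group \<open>F\<^sub>p\<^sup>*\<close>; for \<open>p\<close> prime its carrier consists of the representatives
  \<open>1, \<dots>, p - 1\<close>.\<close>

definition Fp_star :: "nat \<Rightarrow> int monoid" where
  "Fp_star p = units_of (residue_ring (int p))"

definition Cstar :: "complex monoid" where
  "Cstar = \<lparr>carrier = UNIV - {0}, monoid.mult = (*), one = 1\<rparr>"

text \<open>For \<open>p\<close> prime, \<open>F\<^sub>p\<^sup>*\<close> is cyclic, so the described subgroup exists and is unique
  whenever \<open>m\<close> divides \<open>p - 1\<close>.\<close>

definition subgroup_of_index :: "nat \<Rightarrow> nat \<Rightarrow> int set" where
  "subgroup_of_index p m =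
     (THE H. subgroup H (Fp_star p) \<and> card (rcosets\<^bsub>Fp_star p\<^esub> H) = m)"

text \<open>\<open>hom\<close> does not constrain functions outside the carrier; requiring the value \<open>0\<close> there
  makes each character a single function, and is the usual extension of \<open>\<chi>\<close> by \<open>0\<close> to
  the residue class of \<open>0\<close>.\<close>

definition mult_chars :: "nat \<Rightarrow> (int \<Rightarrow> complex) set" where
  "mult_chars p =
     {\<chi> \<in> hom (Fp_star p) Cstar. \<forall>a. a \<notin> carrier (Fp_star p) \<longrightarrow> \<chi> a = 0}"

definition chars_trivial :: "nat \<Rightarrow> nat \<Rightarrow> (int \<Rightarrow> complex) set" where
  "chars_trivial p m = {\<chi> \<in> mult_chars p. \<forall>a \<in> subgroup_of_index p m. \<chi> a = 1}"

text \<open>An integer \<open>n\<close> is fed to a character through its representative \<open>n mod p\<close>.\<close>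

definition odd_chars_trivial :: "nat \<Rightarrow> nat \<Rightarrow> (int \<Rightarrow> complex) set" where
  "odd_chars_trivial p m = {\<chi> \<in> chars_trivial p m. \<chi> ((- 1) mod int p) = - 1}"

text \<open>The series is only conditionally convergent, so it is the ordered sum
  (\<open>suminf\<close>), with \<open>n = Suc k\<close>.\<close>

definition L_one :: "nat \<Rightarrow> (int \<Rightarrow> complex) \<Rightarrow> complex" where
  "L_one p \<chi> = (\<Sum>k. \<chi> (int (Suc k) mod int p) / of_nat (Suc k))"

definition L_moment :: "nat \<Rightarrow> nat \<Rightarrow> nat \<Rightarrow> real" where
  "L_moment \<nu> p m = 2 / real m * (\<Sum>\<chi>\<in>odd_chars_trivial p m. cmod (L_one p \<chi>) ^ \<nu>)"

definition divisor_count :: "nat \<Rightarrow> nat" where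
  "divisor_count n = card {k. k dvd n}"

end

theory Submission
  imports Defs "HOL-Analysis.Summation_Tests" "HOL-Computational_Algebra.Polynomial"
begin

text \<open>
  Write \<open>a \<sim> b\<close> if \<open>a / b\<close> modulo \<open>p\<close> lies in \<open>\<plusminus>G\<close>, where \<open>G\<close> is the subgroup of order \<open>d\<close>. Truncating the
  \<open>L\<close>-series and using orthogonality of the odd characters trivial on \<open>G\<close>, the fourth moment becomes a
  sum of \<open>\<plusminus>\<tau>(a) \<tau>(b) / (a b)\<close> over \<open>a \<sim> b\<close>, whose diagonal is the main term. If \<open>a \<sim> b\<close> and
  \<open>a \<noteq> b\<close>, then \<open>p\<close> divides a nonzero value of a homogenised cyclotomic polynomial at \<open>(a, b)\<close>, which
  forces \<open>a + b \<ge> X = p powr (1 / \<phi>(d))\<close>. This is not enough when \<open>X\<close> grows slowly, because there are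
  about \<open>2 d\<close> residue classes to sum over. However, two multiplicatively independent small ratios
  in \<open>\<plusminus>G\<close> would generate more than \<open>2 d\<close> distinct elements of \<open>\<plusminus>G\<close>, so all the small reduced ratios
  are powers of a single rational number and their numerators grow geometrically. Hence the
  off-diagonal terms contribute \<open>O(X powr (-1/4))\<close>, uniformly for \<open>\<phi>(d) \<le> ln p\<close>.
\<close>

unbundle no vec_syntax

section \<open>Euler's totient of odd numbers\<close>

text \<open>What has to be balanced is the range of the dependence argument against the loss of a
  factor \<open>d\<close> beyond it. Write \<phi> for the totient of \<open>d\<close>, ln p = l
  \<phi>, so that X = exp l, and q = \<phi>^(1/4). Pigeonhole uses exponents up to about sqrt(2 d),
  so it controls ratios of height up to p^(1 / (2 sqrt(2 d))). This exceeds X by a growing power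
  only if sqrt d is smaller than \<phi> by a power of \<phi>; for odd \<open>d\<close> the
  inequality d^2 \<le> 2 \<phi>^3 yields the height X^(q/5). Beyond it each denominator admits at
  most 2 d numerators modulo \<open>p\<close>, and the polynomial loss d \<le> 2 q^8 is beaten by
  the gain X^(-q/8). When \<phi> is bounded, so is \<open>d\<close>, and the loss is a constant. The
  sums run up to p^4 because the series is cut at p^2 and then squared. The exponent 1/32 in the
  divisor bound is small enough that even at n = p^4 it costs only p^(1/8).\<close>

lemma totient_mult_prime:
  assumes "prime q"
  shows "totient (q * r) = (if q dvd r then q else q - 1) * totient r"
proof (cases "q dvd r")
  case True
  hence "gcd q r = q" by simp
  moreover have "totient q > 0" using assms prime_gt_0_nat by simp
  ultimately show ?thesis using True by (simp add: totient_mult mult.assoc)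
next
  case False
  hence "coprime q r" using assms prime_imp_coprime by blast
  thus ?thesis using False assms by (simp add: totient_mult_coprime totient_prime)
qed

text \<open>The prime \<open>3\<close> is the only odd prime \<open>q\<close> with \<open>(q - 1)\<^sup>3 < q\<^sup>2\<close>; the case distinction accounts for it.\<close>

lemma square_le_totient_cubed_aux:
  "odd d \<Longrightarrow> 8 * d ^ 2 \<le> (if 3 dvd d then 9 else 8) * totient d ^ 3"
proof (induction d rule: less_induct)
  case (less d)
  show ?case
  proof (cases "d = 1")
    case False
    then obtain q where q: "prime q" "q dvd d" using prime_factor_nat by blast
    then obtain r where r: "d = q * r" by blast
    have "d > 0" using less.prems by (rule odd_pos)
    hence "r > 0" "r < d" "odd r" "odd q" using r less.prems prime_gt_1_nat[OF q(1)] by auto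
    hence IH: "8 * r ^ 2 \<le> (if 3 dvd r then 9 else 8) * totient r ^ 3" using less.IH by blast
    have q3: "q \<ge> 3" using prime_ge_2_nat[OF q(1)] \<open>odd q\<close> by (cases "q = 2") auto
    have q2: "q ^ 2 \<le> q ^ 3" using q3 by (intro power_increasing) auto
    show ?thesis
    proof (cases "q dvd r")
      case True
      have "8 * d ^ 2 = q ^ 2 * (8 * r ^ 2)" by (simp add: r power_mult_distrib)
      also have "\<dots> \<le> q ^ 3 * ((if 3 dvd r then 9 else 8) * totient r ^ 3)"
        by (rule mult_mono[OF q2 IH]) auto
      also have "\<dots> = (if 3 dvd r then 9 else 8) * totient d ^ 3"
        using True by (simp add: r totient_mult_prime[OF q(1)] power_mult_distrib)
      also have "\<dots> \<le> (if 3 dvd d then 9 else 8) * totient d ^ 3"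
        by (auto simp: r)
      finally show ?thesis .
    next
      case nd: False
      have tot: "totient d ^ 3 = (q - 1) ^ 3 * totient r ^ 3"
        using nd by (simp add: r totient_mult_prime[OF q(1)] power_mult_distrib)
      show ?thesis
      proof (cases "q = 3")
        case True
        \<comment> \<open>The loss 3^2 / 2^3 = 9/8 is exactly the allowance, and it is incurred only
          once, since here 3 does not divide \<open>r\<close>.\<close>
        thus ?thesis using IH nd tot by (simp add: r power_mult_distrib)
      next
        case q3': False
        have "q \<noteq> 4" using \<open>odd q\<close> by auto
        with q3 q3' have "5 \<le> q" by linarith
        then obtain k where k: "q = k + 5" by (metis le_Suc_ex add.commute)
        have "q ^ 2 \<le> (q - 1) ^ 3"
          unfolding k by (simp add: power2_eq_square power3_eq_cube algebra_simps)
        hence "q ^ 2 * (8 * r ^ 2) \<le> (q - 1) ^ 3 * ((if 3 dvd r then 9 else 8) * totient r ^ 3)"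
          by (rule mult_mono[OF _ IH]) auto
        also have "\<dots> = (if 3 dvd d then 9 else 8) * totient d ^ 3"
        proof -
          have prime3: "prime (3::nat)" by simp
          hence "\<not> 3 dvd q" using q(1) q3' primes_dvd_imp_eq by blast
          hence "3 dvd d \<longleftrightarrow> 3 dvd r" unfolding r using prime_dvd_mult_iff[OF prime3] by simp
          thus ?thesis by (simp add: tot)
        qed
        finally show ?thesis by (simp add: r power_mult_distrib algebra_simps)
      qed
    qed
  qed auto
qed

text \<open>The exponent is what matters: sqrt(2 d) becomes O(totient d powr (3/4)), a power below
  totient d, and this bounds the exponents in the pigeonhole argument.\<close>

lemma odd_square_le_totient_cubed:
  assumes "odd d"
  shows "d ^ 2 \<le> 2 * totient d ^ 3"
  using square_le_totient_cubed_aux[OF assms] by (simp split: if_splits)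

section \<open>The divisor function\<close>

lemma divisor_count_mult_le:
  assumes "a > 0" "b > 0"
  shows "divisor_count (a * b) \<le> divisor_count a * divisor_count b"
proof -
  have "{k. k dvd a * b} \<subseteq> (\<lambda>(x, y). x * y) ` ({k. k dvd a} \<times> {k. k dvd b})"
  proof
    fix k assume "k \<in> {k. k dvd a * b}"
    then obtain x y where "k = x * y" "x dvd a" "y dvd b" using division_decomp[of k a b] by auto
    thus "k \<in> (\<lambda>(x, y). x * y) ` ({k. k dvd a} \<times> {k. k dvd b})"
      by (intro image_eqI[of _ _ "(x, y)"]) auto
  qed
  hence "divisor_count (a * b) \<le> card ((\<lambda>(x, y). x * y) ` ({k. k dvd a} \<times> {k. k dvd b}))"
    unfolding divisor_count_def using assms by (intro card_mono) auto
  also have "\<dots> \<le> card ({k. k dvd a} \<times> {k. k dvd b})" using assms by (intro card_image_le) auto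
  finally show ?thesis by (simp add: divisor_count_def card_cartesian_product)
qed

lemma divisor_count_prime_power: "prime q \<Longrightarrow> divisor_count (q ^ k) = k + 1"
proof -
  assume q: "prime (q::nat)"
  have "{d. d dvd q ^ k} = (\<lambda>i. q ^ i) ` {..k}"
    using divides_primepow_nat[OF q] by auto
  moreover have "inj_on (\<lambda>i. q ^ i) {..k}"
    using prime_gt_1_nat[OF q] by (auto simp: inj_on_def)
  ultimately show ?thesis by (simp add: divisor_count_def card_image)
qed

text \<open>The comparison is made prime by prime. For q \<ge> 2^(1/\<epsilon>) one has k + 1 \<le>
  q^(k \<epsilon>) outright; each of the fewer than \<open>P\<close> smaller primes costs at most
  one factor \<open>A\<close>, so A^P serves for all \<open>n\<close>.\<close>

lemma divisor_count_bound:
  fixes \<epsilon> :: real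
  assumes "\<epsilon> > 0"
  obtains C where "C > 0" "\<And>n. n > 0 \<Longrightarrow> real (divisor_count n) \<le> C * real n powr \<epsilon>"
proof -
  \<comment> \<open>With e = \<epsilon> ln 2 this choice gives A (1 + k e) \<ge> 1 + k, while 1 + k
    e \<le> exp(k e) = 2^(k \<epsilon>).\<close>
  define A where "A = 1 + 1 / (\<epsilon> * ln 2)"
  define P where "P = nat \<lceil>2 powr (1 / \<epsilon>)\<rceil>"
  have A: "A \<ge> 1" using assms by (simp add: A_def)
  have small: "real (k + 1) \<le> A * (real q ^ k) powr \<epsilon>" if "q \<ge> 2" for k q :: nat
  proof -
    have "1 + real k * (\<epsilon> * ln 2) \<le> exp (real k * (\<epsilon> * ln 2))" by (rule exp_ge_add_one_self)
    also have "\<dots> = (2 ^ k) powr \<epsilon>" by (simp add: powr_def ln_realpow algebra_simps)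
    also have "\<dots> \<le> (real q ^ k) powr \<epsilon>" using that assms by (intro powr_mono2 power_mono) auto
    finally have "A * (1 + real k * (\<epsilon> * ln 2)) \<le> A * (real q ^ k) powr \<epsilon>"
      using A by (intro mult_left_mono) auto
    moreover have "real (k + 1) \<le> A * (1 + real k * (\<epsilon> * ln 2))"
      using assms by (simp add: A_def field_simps)
    ultimately show ?thesis by linarith
  qed
  have large: "real (k + 1) \<le> (real q ^ k) powr \<epsilon>" if "q \<ge> P" "q \<ge> 2" for k q :: nat
  proof -
    have "2 = (2 powr (1 / \<epsilon>)) powr \<epsilon>" using assms by (simp add: powr_powr)
    also have "2 powr (1 / \<epsilon>) \<le> real q" using that(1) unfolding P_def by linarith
    hence "(2 powr (1 / \<epsilon>)) powr \<epsilon> \<le> real q powr \<epsilon>" using assms by (intro powr_mono2) auto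
    finally have "2 ^ k \<le> (real q powr \<epsilon>) ^ k" by (intro power_mono) auto
    also have "\<dots> = (real q ^ k) powr \<epsilon>"
      using that by (simp add: powr_realpow[symmetric] powr_powr mult.commute)
    finally have "(2::real) ^ k \<le> (real q ^ k) powr \<epsilon>" .
    moreover have "real (k + 1) \<le> 2 ^ k"
      using less_exp[of k] by (metis Suc_eq_plus1 Suc_leI of_nat_le_iff of_nat_power of_nat_numeral)
    ultimately show ?thesis by linarith
  qed
  \<comment> \<open>The induction removes the full power of one prime at a time, so that
    \<open>A\<close> is paid once per small prime and not once per multiplicity.\<close>
  have main: "real (divisor_count n) \<le> A ^ card {q \<in> prime_factors n. q < P} * real n powr \<epsilon>"
    if "n > 0" for n
    using that
  proof (induction n rule: less_induct)
    case (less n)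
    show ?case
    proof (cases "n = 1")
      case True
      thus ?thesis by (simp add: divisor_count_def)
    next
      case False
      then obtain q where q: "prime q" "q dvd n" using prime_factor_nat by blast
      define k where "k = multiplicity q n"
      obtain r where r: "n = q ^ k * r" "\<not> q dvd r"
        unfolding k_def using multiplicity_decompose'[of n q] q less.prems
        by (metis not_gr_zero not_prime_unit)
      have k: "k > 0" using q less.prems r by (auto intro: Nat.gr0I)
      have q2: "q \<ge> 2" using prime_ge_2_nat[OF q(1)] .
      have r0: "r > 0" using less.prems r by (auto intro: Nat.gr0I)
      have "1 < q ^ k" using k q2 by (intro one_less_power) auto
      hence rn: "r < n" using r(1) r0 by simp
      have pf: "prime_factors n = insert q (prime_factors r)"
        using r0 q k prime_gt_0_nat[OF q(1)] unfolding r(1)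
        by (subst prime_factors_product) (auto simp: prime_factors_power prime_prime_factors)
      have qr: "q \<notin> prime_factors r" using r by auto
      have IH: "real (divisor_count r) \<le> A ^ card {q \<in> prime_factors r. q < P} * real r powr \<epsilon>"
        using less.IH[OF rn r0] .
      have "real (divisor_count n) \<le> real ((k + 1) * divisor_count r)"
        using divisor_count_mult_le[of "q ^ k" r] r0 q2 divisor_count_prime_power[OF q(1), of k]
        unfolding r(1) by (simp only: of_nat_le_iff) auto
      also have "\<dots> = real (k + 1) * real (divisor_count r)" by (rule of_nat_mult)
      also have "\<dots> \<le> (A ^ card {q \<in> prime_factors n. q < P} / A ^ card {q \<in> prime_factors r. q < P}
            * (real q ^ k) powr \<epsilon>) * (A ^ card {q \<in> prime_factors r. q < P} * real r powr \<epsilon>)"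
      proof (intro mult_mono IH)
        show "real (k + 1) \<le> A ^ card {q \<in> prime_factors n. q < P} / A ^ card {q \<in> prime_factors r. q < P}
            * (real q ^ k) powr \<epsilon>"
        proof (cases "q < P")
          case True
          hence "{q \<in> prime_factors n. q < P} = insert q {q \<in> prime_factors r. q < P}"
            using pf by auto
          thus ?thesis using small[OF q2, of k] qr A by simp
        next
          case False
          hence "{q \<in> prime_factors n. q < P} = {q \<in> prime_factors r. q < P}"
            using pf by auto
          thus ?thesis using large[OF _ q2, of k] False A by simp
        qed
      qed (use A in auto)
      also have "\<dots> = A ^ card {q \<in> prime_factors n. q < P} * real n powr \<epsilon>"
        using A by (simp add: r(1) powr_mult)
      finally show ?thesis .
    qed
  qed
  show ?thesis
  proof (rule that[of "A ^ P"])
    show "A ^ P > 0" using A by simp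
    fix n :: nat assume n: "n > 0"
    have "card {q \<in> prime_factors n. q < P} \<le> card {..<P}" by (intro card_mono) auto
    hence "A ^ card {q \<in> prime_factors n. q < P} \<le> A ^ P" using A by (intro power_increasing) auto
    thus "real (divisor_count n) \<le> A ^ P * real n powr \<epsilon>"
      using main[OF n] by (meson mult_right_mono order_trans powr_ge_zero)
  qed
qed

section \<open>Cyclotomic forms\<close>

text \<open>For \<open>n = 0\<close> both conditions hold for every \<open>z\<close>, which is why
  positivity is assumed throughout.\<close>

definition primitive_unity_roots :: "nat \<Rightarrow> complex set" where
  "primitive_unity_roots n = {z. z ^ n = 1 \<and> (\<forall>k. 0 < k \<and> k < n \<longrightarrow> z ^ k \<noteq> 1)}"

lemma finite_primitive_unity_roots: "n > 0 \<Longrightarrow> finite (primitive_unity_roots n)"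
  using finite_roots_unity[of n, where 'a = complex] by (auto simp: primitive_unity_roots_def elim!: finite_subset[rotated])

lemma roots_unity_partition:
  assumes "n > 0"
  shows "{z::complex. z ^ n = 1} = (\<Union>f\<in>{f. f dvd n}. primitive_unity_roots f)"
proof (intro equalityI subsetI)
  fix z :: complex assume "z \<in> {z. z ^ n = 1}"
  hence z: "z ^ n = 1" by simp
  define f where "f = (LEAST k. 0 < k \<and> z ^ k = 1)"
  have f: "0 < f \<and> z ^ f = 1"
    unfolding f_def by (rule LeastI[of _ n]) (use z assms in auto)
  have least: "z ^ k \<noteq> 1" if "0 < k" "k < f" for k
    using not_less_Least[of k "\<lambda>k. 0 < k \<and> z ^ k = 1"] that by (auto simp: f_def)
  have "z ^ (f * (n div f) + n mod f) = 1" using z by simp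
  hence "z ^ (n mod f) = 1" using f by (simp only: power_add power_mult) simp
  hence "n mod f = 0" using least[of "n mod f"] f by auto
  thus "z \<in> (\<Union>f\<in>{f. f dvd n}. primitive_unity_roots f)"
    using f least by (auto simp: primitive_unity_roots_def)
qed (auto simp: primitive_unity_roots_def elim!: dvdE simp: power_mult)

lemma primitive_unity_roots_disjoint:
  assumes "0 < f" "0 < g" "f \<noteq> g"
  shows "primitive_unity_roots f \<inter> primitive_unity_roots g = {}"
  using assms by (cases f g rule: linorder_cases) (auto simp: primitive_unity_roots_def)

lemma primitive_unity_root_dvd:
  assumes "z \<in> primitive_unity_roots n" "n > 0" "z ^ k = 1"
  shows "n dvd k"
proof -
  have z: "z ^ n = 1" "\<And>j. 0 < j \<Longrightarrow> j < n \<Longrightarrow> z ^ j \<noteq> 1"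
    using assms(1) by (auto simp: primitive_unity_roots_def)
  have "z ^ (n * (k div n) + k mod n) = 1" using assms(3) by simp
  hence "z ^ (k mod n) = 1" using z(1) by (simp only: power_add power_mult) simp
  hence "k mod n = 0" using z(2)[of "k mod n"] assms(2) by auto
  thus ?thesis by blast
qed

text \<open>Summed over the divisors of \<open>n\<close>, both counts give \<open>n\<close>; strong
  induction cancels the proper divisors and leaves the term at \<open>n\<close>.\<close>

lemma card_primitive_unity_roots: "n > 0 \<Longrightarrow> card (primitive_unity_roots n) = totient n"
proof (induction n rule: less_induct)
  case (less n)
  let ?D = "{f. f dvd n}" and ?D' = "{f. f dvd n \<and> f < n}"
  have D: "?D = insert n ?D'" using less.prems by (auto dest: dvd_imp_le)
  have pos: "0 < f" if "f dvd n" for f using that less.prems by (auto intro: Nat.gr0I)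
  have fin: "finite ?D'" by simp
  have "n = card {z::complex. z ^ n = 1}" using card_roots_unity_eq[of n] less.prems by simp
  also have "\<dots> = (\<Sum>f\<in>?D. card (primitive_unity_roots f))"
    unfolding roots_unity_partition[OF less.prems] using less.prems
    by (intro card_UN_disjoint ballI impI)
       (simp_all add: finite_primitive_unity_roots primitive_unity_roots_disjoint pos)
  finally have "(\<Sum>f\<in>?D. card (primitive_unity_roots f)) = n" by simp
  moreover have "(\<Sum>f\<in>?D. totient f) = n" by (rule totient_divisor_sum)
  moreover have "(\<Sum>f\<in>?D'. card (primitive_unity_roots f)) = (\<Sum>f\<in>?D'. totient f)"
    by (intro sum.cong less.IH) (auto intro: pos)
  ultimately show ?case unfolding D using fin by simp
qed

section \<open>Cyclotomic polynomials and the integrality of their coefficients\<close>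

definition cyclotomic :: "nat \<Rightarrow> complex poly" where
  "cyclotomic n = (\<Prod>z\<in>primitive_unity_roots n. [:-z, 1:])"

text \<open>Both sides are monic of degree \<open>n\<close>, so a nonzero difference would have
  degree below \<open>n\<close> and yet vanish at \<open>n\<close> points.\<close>

lemma prod_roots_unity_poly:
  assumes "n > 0"
  shows "(\<Prod>z\<in>{z::complex. z ^ n = 1}. [:-z, 1:]) = monom 1 n - 1"
proof -
  let ?A = "{z::complex. z ^ n = 1}"
  let ?P = "\<Prod>z\<in>?A. [:-z, 1:]" and ?Q = "monom 1 n - 1 :: complex poly"
  have fin: "finite ?A" using finite_roots_unity[of n] assms by simp
  have degP: "degree ?P = n"
    using card_roots_unity_eq[of n] assms by (subst degree_prod_eq_sum_degree) auto
  have degQ: "degree ?Q \<le> n"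
    by (intro degree_diff_le degree_monom_le) auto
  have lcP: "lead_coeff ?P = 1" by (simp add: lead_coeff_prod)
  have lcQ: "coeff ?Q n = 1" using assms by simp
  have "?P - ?Q = 0"
  proof (rule ccontr)
    assume nz: "?P - ?Q \<noteq> 0"
    have "degree (?P - ?Q) \<le> n" using degP degQ by (metis degree_diff_le le_refl)
    moreover have "coeff (?P - ?Q) n = 0" using lcP lcQ degP by simp
    ultimately have deg: "degree (?P - ?Q) < n" using nz
      by (metis le_neq_implies_less leading_coeff_neq_0)
    have "?A \<subseteq> {z. poly (?P - ?Q) z = 0}"
      using fin by (auto simp: poly_prod poly_monom)
    hence "card ?A \<le> card {z. poly (?P - ?Q) z = 0}" by (intro card_mono poly_roots_finite nz)
    also have "\<dots> \<le> degree (?P - ?Q)" by (rule card_poly_roots_bound[OF nz])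
    finally show False using deg card_roots_unity_eq[of n] assms by simp
  qed
  thus ?thesis by simp
qed

lemma prod_cyclotomic:
  assumes "n > 0"
  shows "(\<Prod>f | f dvd n. cyclotomic f) = monom 1 n - 1"
proof -
  have pos: "0 < f" if "f dvd n" for f using that assms by (auto intro: Nat.gr0I)
  show ?thesis
    unfolding prod_roots_unity_poly[OF assms, symmetric] roots_unity_partition[OF assms] cyclotomic_def
    using assms pos by (subst prod.UNION_disjoint)
      (auto simp: finite_primitive_unity_roots primitive_unity_roots_disjoint)
qed

lemma int_coeffs_mult:
  assumes "\<And>i. coeff p i \<in> \<int>" "\<And>i. coeff q i \<in> \<int>"
  shows "coeff (p * q :: complex poly) i \<in> \<int>"
  using assms by (auto simp: coeff_mult)

lemma int_coeffs_prod:
  assumes "\<And>x i. x \<in> A \<Longrightarrow> coeff (f x) i \<in> \<int>"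
  shows "coeff (\<Prod>x\<in>A. f x :: complex poly) i \<in> \<int>"
  using assms
proof (induction A arbitrary: i rule: infinite_finite_induct)
  case (insert x A)
  thus ?case by (auto intro!: int_coeffs_mult)
qed (auto simp: coeff_1)

text \<open>Division by a monic integral polynomial stays integral: \<open>C\<close> and
  \<open>B * C\<close> have the same leading coefficient, and removing the leading term of
  \<open>C\<close> lowers its degree.\<close>

lemma int_coeffs_monic_cancel:
  fixes B C :: "complex poly"
  assumes "\<And>i. coeff B i \<in> \<int>" "lead_coeff B = 1" "\<And>i. coeff (B * C) i \<in> \<int>"
  shows "coeff C i \<in> \<int>"
  using assms(3)
proof (induction "if C = 0 then 0 else Suc (degree C)" arbitrary: C i rule: less_induct)
  case less
  show ?case
  proof (cases "C = 0")
    case False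
    define c where "c = lead_coeff C"
    define C' where "C' = C - monom c (degree C)"
    have c: "c \<in> \<int>"
      using less.prems[of "degree (B * C)"] assms(2) by (simp add: lead_coeff_mult c_def)
    have "coeff C' (degree C) = 0" by (simp add: C'_def c_def)
    moreover have "degree C' \<le> degree C" unfolding C'_def
      by (intro degree_diff_le) (auto simp: degree_monom_le)
    ultimately have smaller: "C' = 0 \<or> degree C' < degree C"
      by (metis le_neq_implies_less leading_coeff_neq_0)
    have "B * C' = B * C - B * monom c (degree C)" by (simp add: C'_def algebra_simps)
    hence BC': "coeff (B * C') i \<in> \<int>" for i
      using less.prems[of i] assms(1) c
      by (simp add: Ints_diff int_coeffs_mult)
    have "coeff C' i \<in> \<int>"
      using smaller False BC' by (cases "C' = 0") (auto intro: less.hyps)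
    hence "coeff C' i + coeff (monom c (degree C)) i \<in> \<int>" using c by (intro Ints_add) auto
    thus ?thesis by (simp add: C'_def)
  qed auto
qed

lemma monic_cyclotomic: "lead_coeff (cyclotomic n) = 1"
  by (simp add: cyclotomic_def lead_coeff_prod)

text \<open>The product over the proper divisors is monic and integral by induction, and it is the
  cofactor of \<open>cyclotomic n\<close> in x^n - 1.\<close>

lemma int_coeffs_cyclotomic: "n > 0 \<Longrightarrow> coeff (cyclotomic n) i \<in> \<int>"
proof (induction n arbitrary: i rule: less_induct)
  case (less n)
  let ?D' = "{f. f dvd n \<and> f < n}"
  let ?B = "\<Prod>f\<in>?D'. cyclotomic f"
  have D: "{f. f dvd n} = insert n ?D'" using less.prems by (auto dest: dvd_imp_le)
  have B: "coeff ?B i \<in> \<int>" for i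
    using less by (intro int_coeffs_prod) (auto intro: Nat.gr0I)
  have "?B * cyclotomic n = monom 1 n - 1"
    using prod_cyclotomic[OF less.prems] unfolding D by (simp add: mult.commute)
  hence BC: "coeff (?B * cyclotomic n) i \<in> \<int>" for i by (simp add: coeff_1)
  show ?case
    by (rule int_coeffs_monic_cancel[OF B _ BC]) (simp add: lead_coeff_prod monic_cyclotomic)
qed

text \<open>The homogenisation of the cyclotomic polynomial. The product over its roots makes the
  bound by a power of a + b immediate.\<close>

definition cyclotomic_form :: "nat \<Rightarrow> complex \<Rightarrow> complex \<Rightarrow> complex" where
  "cyclotomic_form n a b = (\<Prod>z\<in>primitive_unity_roots n. a - z * b)"

lemma cyclotomic_form_Ints:
  assumes "n > 0" "a \<in> \<int>" "b \<in> \<int>" "b \<noteq> 0"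
  shows "cyclotomic_form n a b \<in> \<int>"
proof -
  let ?N = "card (primitive_unity_roots n)"
  have deg: "degree (cyclotomic n) = ?N"
    unfolding cyclotomic_def by (subst degree_prod_eq_sum_degree) auto
  have "cyclotomic_form n a b = (\<Prod>z\<in>primitive_unity_roots n. b * (a / b - z))"
    unfolding cyclotomic_form_def using assms by (intro prod.cong) (auto simp: field_simps)
  also have "\<dots> = b ^ ?N * poly (cyclotomic n) (a / b)"
    by (simp add: prod.distrib cyclotomic_def poly_prod)
  also have "\<dots> = (\<Sum>i\<le>?N. coeff (cyclotomic n) i * a ^ i * b ^ (?N - i))"
    unfolding poly_altdef deg sum_distrib_left using assms
    by (intro sum.cong refl) (auto simp: power_divide power_diff field_simps)
  also have "\<dots> \<in> \<int>"
    using assms int_coeffs_cyclotomic by (intro Ints_sum Ints_mult Ints_power) auto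
  finally show ?thesis .
qed

lemma prod_cyclotomic_form:
  assumes "n > 0" "b \<noteq> 0"
  shows "(\<Prod>f | f dvd n. cyclotomic_form f a b) = a ^ n - b ^ n"
proof -
  have pos: "0 < f" if "f dvd n" for f using that assms by (auto intro: Nat.gr0I)
  let ?A = "{z::complex. z ^ n = 1}"
  have "(\<Prod>f | f dvd n. cyclotomic_form f a b) = (\<Prod>z\<in>?A. a - z * b)"
    unfolding roots_unity_partition[OF assms(1)] cyclotomic_form_def
    using assms pos by (subst prod.UNION_disjoint)
      (auto simp: finite_primitive_unity_roots primitive_unity_roots_disjoint)
  also have "\<dots> = (\<Prod>z\<in>?A. b * (a / b - z))"
    using assms by (intro prod.cong) (auto simp: field_simps)
  also have "\<dots> = b ^ n * poly (\<Prod>z\<in>?A. [:-z, 1:]) (a / b)"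
    using card_roots_unity_eq[OF assms(1)] by (simp add: prod.distrib poly_prod)
  also have "\<dots> = a ^ n - b ^ n"
    using assms by (simp add: prod_roots_unity_poly poly_monom field_simps)
  finally show ?thesis .
qed

text \<open>Take the least divisor \<open>e\<close> of \<open>n\<close> with a^e = b^e modulo
  \<open>p\<close>. Some form of index \<open>f\<close> dividing \<open>e\<close> is divisible by
  \<open>p\<close>, and it divides a^f - b^f, so f = e by minimality. Its value is a product of
  totient e factors of norm at most a + b.\<close>

theorem power_cong_lower_bound:
  fixes a b n p :: nat
  assumes "prime p" "n > 0" "a > 0" "b > 0" "a \<noteq> b" "[a ^ n = b ^ n] (mod p)"
  shows "p \<le> (a + b) ^ totient n"
proof -
  define e where "e = (LEAST e. e dvd n \<and> [a ^ e = b ^ e] (mod p))"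
  have e: "e dvd n" "[a ^ e = b ^ e] (mod p)"
    using LeastI[of "\<lambda>e. e dvd n \<and> [a ^ e = b ^ e] (mod p)" n] assms by (auto simp: e_def)
  have least: "\<not> [a ^ f = b ^ f] (mod p)" if "f dvd n" "f < e" for f
    using not_less_Least[of f "\<lambda>e. e dvd n \<and> [a ^ e = b ^ e] (mod p)"] that by (auto simp: e_def)
  have epos: "e > 0" using e assms by (auto intro: Nat.gr0I)
  have pos: "0 < f" if "f dvd n" for f using that assms by (auto intro: Nat.gr0I)
  have "\<exists>z. of_int z = cyclotomic_form f (of_nat a) (of_nat b)" if "f dvd n" for f
    using cyclotomic_form_Ints[of f "of_nat a" "of_nat b"] assms pos[OF that] by (auto elim!: Ints_cases)
  then obtain N where N: "of_int (N f) = cyclotomic_form f (of_nat a) (of_nat b)" if "f dvd n" for f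
    by metis
  have prodN: "(\<Prod>f | f dvd g. N f) = int a ^ g - int b ^ g" if "g dvd n" for g
  proof -
    have "of_int (\<Prod>f | f dvd g. N f) = (\<Prod>f | f dvd g. cyclotomic_form f (of_nat a) (of_nat b))"
      unfolding of_int_prod using that N by (intro prod.cong) auto
    also have "\<dots> = of_int (int a ^ g - int b ^ g)"
      using prod_cyclotomic_form[of g "of_nat b" "of_nat a"] pos[OF that] assms by simp
    finally show ?thesis by (simp only: of_int_eq_iff)
  qed
  have cong: "int p dvd int a ^ g - int b ^ g \<longleftrightarrow> [a ^ g = b ^ g] (mod p)" for g
    by (metis cong_iff_dvd_diff cong_int_iff of_nat_power)
  have "prime (int p)" using assms by simp
  moreover have "int p dvd (\<Prod>f | f dvd e. N f)" using prodN[OF e(1)] e(2) cong by simp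
  moreover have fin: "finite {f. f dvd e}" using epos by simp
  ultimately obtain f where f: "f dvd e" "int p dvd N f"
    by (auto simp: prime_dvd_prod_iff)
  have "f = e"
  proof (rule ccontr)
    assume "f \<noteq> e"
    hence fe: "f < e" "f dvd n" using f(1) epos dvd_trans[OF f(1) e(1)] by (auto dest: dvd_imp_le)
    have "N f dvd (\<Prod>g | g dvd f. N g)"
      using fe pos by (intro dvd_prodI) auto
    hence "int p dvd int a ^ f - int b ^ f" using f fe prodN dvd_trans by metis
    thus False using least cong fe by blast
  qed
  hence pN: "int p dvd N e" using f by simp
  let ?A = "primitive_unity_roots e"
  have finA: "finite ?A" using finite_primitive_unity_roots epos by simp
  have unit: "norm z = 1" if "z \<in> ?A" for z
    using that epos power_eq_1_iff[of z e] by (auto simp: primitive_unity_roots_def)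
  \<comment> \<open>The roots have norm 1, so a zero factor would force a = b; hence the integer
    divisible by \<open>p\<close> is nonzero.\<close>
  have "of_nat a - z * of_nat b \<noteq> 0" if "z \<in> ?A" for z
  proof
    assume "of_nat a - z * of_nat b = 0"
    hence "of_nat a = z * of_nat b" by simp
    hence "norm (of_nat a :: complex) = norm (z * of_nat b)" by (simp only:)
    thus False using assms unit[OF that] by (simp add: norm_mult)
  qed
  hence "cyclotomic_form e (of_nat a) (of_nat b) \<noteq> 0"
    unfolding cyclotomic_form_def using finA by simp
  hence "N e \<noteq> 0" using N[OF e(1)] by (metis of_int_0)
  hence "int p \<le> \<bar>N e\<bar>" using dvd_imp_le_int[OF _ pN] by simp
  hence "real p \<le> of_int \<bar>N e\<bar>" by linarith
  also have "\<dots> = norm (cyclotomic_form e (of_nat a) (of_nat b))"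
    by (simp add: N[OF e(1), symmetric])
  also have "\<dots> = (\<Prod>z\<in>?A. norm (of_nat a - z * of_nat b))"
    by (simp add: cyclotomic_form_def prod_norm)
  also have "\<dots> \<le> (\<Prod>z\<in>?A. real a + real b)"
  proof (intro prod_mono conjI)
    fix z assume "z \<in> ?A"
    thus "norm (of_nat a - z * of_nat b) \<le> real a + real b"
      using norm_triangle_ineq4[of "of_nat a" "z * of_nat b"] unit by (simp add: norm_mult)
  qed auto
  also have "\<dots> = real ((a + b) ^ totient e)"
    using card_primitive_unity_roots[OF epos] by simp
  also have "\<dots> \<le> real ((a + b) ^ totient n)"
  proof -
    have "totient e \<le> totient n"
      using totient_dvd_mono[OF e(1)] assms by simp
    thus ?thesis using assms by (simp only: of_nat_le_iff) (intro power_increasing, auto)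
  qed
  finally show ?thesis by (simp only: of_nat_le_iff)
qed

section \<open>Multiplicative dependence of small solutions\<close>

text \<open>
  By pigeonhole, two of the \<open>(K + 1)\<^sup>2\<close> products \<open>(u1/v1)^i (u2/v2)^j\<close> agree modulo \<open>p\<close>; the bound
  on \<open>Z\<close> turns the congruence into an equality of rationals.
\<close>

lemma dependent_pairs:
  fixes u1 v1 u2 v2 p D K Z :: nat
  assumes p: "prime p" and D: "0 < D" "D < (K + 1) ^ 2" and Z: "Z ^ (2 * K) < p"
    and 1: "coprime u1 v1" "0 < v1" "v1 < u1" "u1 \<le> Z" "[u1 ^ D = v1 ^ D] (mod p)"
    and 2: "coprime u2 v2" "0 < v2" "v2 < u2" "u2 \<le> Z" "[u2 ^ D = v2 ^ D] (mod p)"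
  obtains I J where "0 < I" "0 < J" "u1 ^ I = u2 ^ J" "v1 ^ I = v2 ^ J"
proof -
  have K: "K > 0" using D by (intro Nat.gr0I) auto
  have "Z \<le> Z ^ (2 * K)" using K 1 by (intro self_le_power) auto
  hence Zp: "Z < p" using Z by linarith
  have cop: "coprime x p" if "0 < x" "x \<le> Z" for x
    using that Zp p prime_imp_coprime[of p x] by (metis coprime_commute dvd_imp_le le_trans not_le)
  \<comment> \<open>The residue \<open>g\<close> represents u / v modulo \<open>p\<close>; it lies
    among the roots of x^D = 1.\<close>
  have ex: "\<exists>g. [g * v = u] (mod p) \<and> coprime g p \<and> [g ^ D = 1] (mod p)"
    if uv: "0 < v" "v < u" "u \<le> Z" "[u ^ D = v ^ D] (mod p)" for u v
  proof -
    have cv: "coprime v p" and cu: "coprime u p" using cop uv by auto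
    obtain x where x: "[v * x = 1] (mod p)" using cong_solve_coprime_nat[OF cv] by auto
    have "[v * x * u = 1 * u] (mod p)" using x by (rule cong_scalar_right)
    hence gv: "[(u * x) * v = u] (mod p)" by (simp add: mult_ac)
    have "[u ^ D * x ^ D = v ^ D * x ^ D] (mod p)" using uv(4) by (rule cong_scalar_right)
    also have "v ^ D * x ^ D = (v * x) ^ D" by (simp add: power_mult_distrib)
    also have "[(v * x) ^ D = 1 ^ D] (mod p)" using x by (rule cong_pow)
    finally have "[(u * x) ^ D = 1] (mod p)" by (simp add: power_mult_distrib)
    moreover have "coprime x p"
      using x by (metis cong_imp_coprime cong_sym coprime_1_left coprime_mult_left_iff)
    ultimately show ?thesis using gv cu by (intro exI[of _ "u * x"]) auto
  qed
  obtain g1 where g1: "[g1 * v1 = u1] (mod p)" "coprime g1 p" "[g1 ^ D = 1] (mod p)"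
    using ex[of v1 u1] 1 by blast
  obtain g2 where g2: "[g2 * v2 = u2] (mod p)" "coprime g2 p" "[g2 ^ D = 1] (mod p)"
    using ex[of v2 u2] 2 by blast
  define f where "f = (\<lambda>(i, j). g1 ^ i * g2 ^ j mod p)"
  define A where "A = {x\<in>{..<p}. [x ^ D = 1] (mod p)}"
  have "f ` ({..K} \<times> {..K}) \<subseteq> A"
  proof safe
    fix i j
    have "[(g1 ^ i * g2 ^ j) ^ D = (g1 ^ D) ^ i * (g2 ^ D) ^ j] (mod p)"
      by (simp add: power_mult_distrib flip: power_mult) (simp add: mult.commute)
    also have "[(g1 ^ D) ^ i * (g2 ^ D) ^ j = 1 ^ i * 1 ^ j] (mod p)"
      using g1 g2 by (intro cong_mult cong_pow)
    finally have "[(g1 ^ i * g2 ^ j) ^ D = 1] (mod p)" by simp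
    moreover have "[(g1 ^ i * g2 ^ j mod p) ^ D = (g1 ^ i * g2 ^ j) ^ D] (mod p)"
      by (intro cong_pow) simp
    ultimately show "f (i, j) \<in> A"
      using prime_gt_0_nat[OF p] cong_trans by (auto simp: f_def A_def)
  qed
  \<comment> \<open>The collision: (K + 1)^2 exponent pairs map into at most \<open>D\<close> roots
    of x^D = 1 modulo the prime.\<close>
  hence "card (f ` ({..K} \<times> {..K})) \<le> card A" by (intro card_mono) (auto simp: A_def)
  also have "\<dots> \<le> D" unfolding A_def by (rule roots_mod_prime_bound[OF p D(1)])
  also have "\<dots> < card ({..K} \<times> {..K})" using D by (simp add: power2_eq_square)
  finally have "\<not> inj_on f ({..K} \<times> {..K})" using card_image by force
  then obtain x y where xy: "x \<in> {..K} \<times> {..K}" "y \<in> {..K} \<times> {..K}" "x \<noteq> y" "f x = f y"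
    by (auto simp: inj_on_def)
  obtain a b c e where abce: "x = (a, b)" "y = (c, e)" by (cases x, cases y) blast
  obtain i j i' j' where ij: "i' \<le> i" "i \<le> K" "j \<le> K" "j' \<le> K" "(i, j) \<noteq> (i', j')" "f (i, j) = f (i', j')"
  proof (cases "c \<le> a")
    case True
    thus ?thesis using that[of c a b e] xy abce by auto
  next
    case False
    thus ?thesis using that[of a c e b] xy abce by auto
  qed
  define I where "I = i - i'"
  have i: "i = I + i'" using ij by (simp add: I_def)
  have IK: "I \<le> K" using ij by (simp add: I_def)
  have "[g1 ^ i * g2 ^ j = g1 ^ i' * g2 ^ j'] (mod p)" using ij(6) by (simp add: f_def unique_euclidean_semiring_class.cong_def)
  hence "[g1 ^ i' * (g1 ^ I * g2 ^ j) = g1 ^ i' * g2 ^ j'] (mod p)"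
    by (simp add: i power_add mult_ac)
  hence eq: "[g1 ^ I * g2 ^ j = g2 ^ j'] (mod p)"
    using g1(2) by (subst (asm) cong_mult_lcancel_nat) auto
  \<comment> \<open>Both exponents are at most \<open>K\<close>, so either side of the final
    congruence is at most Z^(2 K) < p, and congruent numbers below \<open>p\<close> are
    equal.\<close>
  have bound: "x ^ I * y ^ J < p" if "x \<le> Z" "y \<le> Z" "J \<le> K" for x y J
  proof -
    have "Z > 0" using 1 by simp
    have "x ^ I * y ^ J \<le> Z ^ I * Z ^ J" using that by (intro mult_mono power_mono) auto
    also have "\<dots> = Z ^ (I + J)" by (simp add: power_add)
    also have "\<dots> \<le> Z ^ (2 * K)" using that IK \<open>Z > 0\<close> by (intro power_increasing) auto
    finally show ?thesis using Z by linarith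
  qed
  show ?thesis
  proof (cases "j \<le> j'")
    case True
    define J where "J = j' - j"
    have j': "j' = J + j" and JK: "J \<le> K" using True ij by (auto simp: J_def)
    have "[g2 ^ j * g1 ^ I = g2 ^ j * g2 ^ J] (mod p)" using eq by (simp add: j' power_add mult_ac)
    hence "[g1 ^ I = g2 ^ J] (mod p)"
      using g2(2) by (subst (asm) cong_mult_lcancel_nat) auto
    \<comment> \<open>Clearing denominators turns a relation between residues into one between small
      integers.\<close>
    hence c: "[g1 ^ I * (v1 ^ I * v2 ^ J) = g2 ^ J * (v1 ^ I * v2 ^ J)] (mod p)" by (rule cong_scalar_right)
    have "[u1 ^ I * v2 ^ J = (g1 * v1) ^ I * v2 ^ J] (mod p)"
      using g1(1) by (intro cong_mult cong_pow) (auto simp: cong_sym)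
    also have "(g1 * v1) ^ I * v2 ^ J = g1 ^ I * (v1 ^ I * v2 ^ J)" by (simp add: power_mult_distrib)
    also have "[\<dots> = g2 ^ J * (v1 ^ I * v2 ^ J)] (mod p)" by (rule c)
    also have "g2 ^ J * (v1 ^ I * v2 ^ J) = v1 ^ I * (g2 * v2) ^ J" by (simp add: power_mult_distrib)
    also have "[\<dots> = v1 ^ I * u2 ^ J] (mod p)" using g2(1) by (intro cong_mult cong_pow) auto
    finally have main: "u1 ^ I * v2 ^ J = v1 ^ I * u2 ^ J"
      using bound[of u1 v2 J] bound[of v1 u2 J] 1 2 JK by (simp add: cong_less_modulus_unique_nat)
    have "coprime (u1 ^ I) (v1 ^ I)" "coprime (u2 ^ J) (v2 ^ J)" using 1 2 by auto
    hence "u1 ^ I dvd u2 ^ J" "u2 ^ J dvd u1 ^ I" "v1 ^ I dvd v2 ^ J" "v2 ^ J dvd v1 ^ I"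
      using main by (metis coprime_dvd_mult_right_iff coprime_dvd_mult_left_iff dvd_triv_left dvd_triv_right coprime_commute)+
    hence e: "u1 ^ I = u2 ^ J" "v1 ^ I = v2 ^ J" by (auto intro: dvd_antisym)
    have "I \<noteq> 0 \<or> J \<noteq> 0" using ij(5) i j' by auto
    moreover have "u1 > 1" "u2 > 1" using 1 2 by auto
    moreover have "I = 0 \<longleftrightarrow> J = 0"
      using e(1) calculation(2,3) by (metis less_irrefl not_gr_zero one_less_power power_0)
    ultimately have "0 < I" "0 < J" by auto
    thus ?thesis using that e by blast
  next
    case False
    \<comment> \<open>In the case of equal signs the product of positive powers of the ratios would
      be 1, which is impossible because both ratios exceed 1.\<close>
    define J where "J = j - j'"
    have j: "j = J + j'" and JK: "J \<le> K" "J > 0" using False ij by (auto simp: J_def)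
    have "[g2 ^ j' * (g1 ^ I * g2 ^ J) = g2 ^ j' * 1] (mod p)" using eq by (simp add: j power_add mult_ac)
    hence "[g1 ^ I * g2 ^ J = 1] (mod p)"
      using g2(2) by (subst (asm) cong_mult_lcancel_nat) auto
    hence c: "[g1 ^ I * g2 ^ J * (v1 ^ I * v2 ^ J) = 1 * (v1 ^ I * v2 ^ J)] (mod p)" by (rule cong_scalar_right)
    have "[u1 ^ I * u2 ^ J = (g1 * v1) ^ I * (g2 * v2) ^ J] (mod p)"
      using g1(1) g2(1) by (intro cong_mult cong_pow) (auto simp: cong_sym)
    also have "(g1 * v1) ^ I * (g2 * v2) ^ J = g1 ^ I * g2 ^ J * (v1 ^ I * v2 ^ J)"
      by (simp add: power_mult_distrib mult_ac)
    also have "[\<dots> = 1 * (v1 ^ I * v2 ^ J)] (mod p)" by (rule c)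
    finally have "u1 ^ I * u2 ^ J = v1 ^ I * v2 ^ J"
      using bound[of u1 u2 J] bound[of v1 v2 J] 1 2 JK by (simp add: cong_less_modulus_unique_nat)
    moreover have "v1 ^ I * v2 ^ J < u1 ^ I * u2 ^ J"
      using 1 2 JK by (intro mult_le_less_imp_less power_mono power_strict_mono) auto
    ultimately show ?thesis by simp
  qed
qed

text \<open>In u1^I = u2^J the ordering u1 \<le> u2 forces J \<le> I, so u1^I divides u2^I and hence
  u1 divides u2. Equality would give I = J and equal denominators, so u1 is a proper
  divisor.\<close>

lemma dependent_pairs_doubling:
  fixes u1 v1 u2 v2 p D K Z :: nat
  assumes p: "prime p" and D: "0 < D" "D < (K + 1) ^ 2" and Z: "Z ^ (2 * K) < p"
    and 1: "coprime u1 v1" "0 < v1" "v1 < u1" "u1 \<le> Z" "[u1 ^ D = v1 ^ D] (mod p)"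
    and 2: "coprime u2 v2" "0 < v2" "v2 < u2" "u2 \<le> Z" "[u2 ^ D = v2 ^ D] (mod p)"
    and le: "u1 \<le> u2" and ne: "(u1, v1) \<noteq> (u2, v2)"
  shows "2 * u1 \<le> u2"
proof -
  obtain I J where IJ: "0 < I" "0 < J" "u1 ^ I = u2 ^ J" "v1 ^ I = v2 ^ J"
    using dependent_pairs[OF p D Z 1 2] .
  have "u1 \<noteq> u2"
  proof
    assume u: "u1 = u2"
    hence "I = J" using IJ(3) 2 by (simp add: power_inject_exp)
    hence "v1 = v2" using IJ by (simp add: power_eq_iff_eq_base)
    thus False using u ne by simp
  qed
  have "J \<le> I"
  proof (rule ccontr)
    assume "\<not> J \<le> I"
    hence "u1 ^ I < u1 ^ J" using 1 by (intro power_strict_increasing) auto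
    also have "\<dots> \<le> u2 ^ J" using le by (intro power_mono) auto
    finally show False using IJ by simp
  qed
  hence "u2 ^ J dvd u2 ^ I" by (rule le_imp_power_dvd)
  hence "u1 ^ I dvd u2 ^ I" using IJ by simp
  hence "u1 dvd u2" using IJ(1) by (metis pow_divides_pow_iff)
  then obtain k where k: "u2 = u1 * k" by blast
  have "k \<noteq> 0" using k 2(3) by (intro notI) simp
  moreover have "k \<noteq> 1" using k \<open>u1 \<noteq> u2\<close> by auto
  ultimately have "2 \<le> k" by simp
  hence "u1 * 2 \<le> u1 * k" by (rule mult_le_mono2)
  thus ?thesis using k by simp
qed

text \<open>After removal of the minimum all other values are at least twice as large, so the
  induction hypothesis applies with a doubled \<open>W\<close>. The constant 4 satisfies 1 + 4 /
  sqrt 2 \<le> 4.\<close>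

lemma sum_inverse_sqrt_doubling:
  fixes f :: "'a \<Rightarrow> real"
  assumes "finite S" "W > 0" "\<And>x. x \<in> S \<Longrightarrow> W \<le> f x"
    and "\<And>x y. x \<in> S \<Longrightarrow> y \<in> S \<Longrightarrow> x \<noteq> y \<Longrightarrow> f x \<le> f y \<Longrightarrow> 2 * f x \<le> f y"
  shows "(\<Sum>x\<in>S. 1 / sqrt (f x)) \<le> 4 / sqrt W"
  using assms
proof (induction S arbitrary: W rule: finite_psubset_induct)
  case (psubset S)
  show ?case
  proof (cases "S = {}")
    case False
    obtain x where x: "x \<in> S" "\<And>y. y \<in> S \<Longrightarrow> f x \<le> f y"
      using arg_min_least[OF psubset.hyps(1) False, where f = f]
        arg_min_if_finite(1)[OF psubset.hyps(1) False, where f = f] by blast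
    have fx: "f x \<ge> W" "f x > 0" using psubset.prems(1) psubset.prems(2)[OF x(1)] by auto
    have "(\<Sum>x\<in>S - {x}. 1 / sqrt (f x)) \<le> 4 / sqrt (2 * f x)"
    proof (rule psubset.IH)
      show "S - {x} \<subset> S" using x by auto
      show "2 * f x \<le> f y" if "y \<in> S - {x}" for y
        using psubset.prems(3)[of x y] x that by auto
      show "2 * f y \<le> f z" if "y \<in> S - {x}" "z \<in> S - {x}" "y \<noteq> z" "f y \<le> f z" for y z
        using psubset.prems(3)[of y z] that by auto
    qed (use fx in auto)
    also have "\<dots> = (4 / sqrt 2) * (1 / sqrt (f x))" by (simp add: real_sqrt_mult)
    also have "\<dots> \<le> 3 * (1 / sqrt (f x))"
    proof (intro mult_right_mono)
      have "4 / 3 \<le> sqrt 2" by (rule real_le_rsqrt) (simp add: power2_eq_square)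
      thus "4 / sqrt 2 \<le> 3" by (simp add: field_simps)
    qed (use fx in auto)
    finally have "(\<Sum>x\<in>S - {x}. 1 / sqrt (f x)) \<le> 3 * (1 / sqrt (f x))" .
    hence "(\<Sum>x\<in>S. 1 / sqrt (f x)) \<le> 4 / sqrt (f x)"
      using x(1) psubset.hyps by (simp add: sum.remove)
    also have "\<dots> \<le> 4 / sqrt W" using fx psubset.prems(1) by (intro divide_left_mono) auto
    finally show ?thesis .
  qed (use psubset.prems in auto)
qed

section \<open>Sums over congruent pairs\<close>

text \<open>Used with D = 2 d: the 2 d solutions of x^(2 d) = 1 modulo \<open>p\<close> form
  \<plusminus>G, so the power congruence says that a / b lies in \<plusminus>G.\<close>

definition cong_pairs :: "nat \<Rightarrow> nat \<Rightarrow> nat \<Rightarrow> (nat \<times> nat) set" where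
  "cong_pairs p D M = {(a, b). a \<in> {1..M} \<and> b \<in> {1..M} \<and> a \<noteq> b \<and> \<not> p dvd a \<and> \<not> p dvd b
     \<and> [a ^ D = b ^ D] (mod p)}"

definition reduced_pairs :: "nat \<Rightarrow> nat \<Rightarrow> nat \<Rightarrow> (nat \<times> nat) set" where
  "reduced_pairs p D M = {(u, v) \<in> cong_pairs p D M. coprime u v \<and> v < u}"

lemma finite_cong_pairs: "finite (cong_pairs p D M)"
  by (rule finite_subset[of _ "{1..M} \<times> {1..M}"]) (auto simp: cong_pairs_def)

lemma reduced_pairs_subset: "reduced_pairs p D M \<subseteq> cong_pairs p D M"
  by (auto simp: reduced_pairs_def)

lemma finite_reduced_pairs: "finite (reduced_pairs p D M)"
  using finite_subset[OF reduced_pairs_subset finite_cong_pairs] .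

text \<open>Up to a constant this majorises the divisor count of \<open>n\<close> over
  \<open>n\<close>, by the divisor bound with exponent 1/32.\<close>

abbreviation wt :: "nat \<Rightarrow> real" where "wt n \<equiv> real n powr (-31/32)"

text \<open>Swapping the entries reduces to b < a. Division by t = gcd a b preserves the congruence
  because \<open>p\<close> does not divide \<open>t\<close>, and the weight is multiplicative, so
  \<open>t\<close> contributes the convergent sum of t^(-31/16).\<close>

lemma sum_cong_pairs_le_reduced:
  assumes p: "prime p"
  shows "(\<Sum>(a, b)\<in>cong_pairs p D M. wt a * wt b)
     \<le> 2 * (\<Sum>t\<in>{1..M}. real t powr (-31/16)) * (\<Sum>(u, v)\<in>reduced_pairs p D M. wt u * wt v)"
proof -
  let ?C = "cong_pairs p D M" and ?R = "reduced_pairs p D M"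
  let ?f = "\<lambda>(a, b). wt a * wt b"
  let ?A = "{(a, b) \<in> ?C. b < a}" and ?B = "{(a, b) \<in> ?C. a < b}"
  have fin: "finite ?A" "finite ?B"
    by (rule finite_subset[OF _ finite_cong_pairs[of p D M]], blast)+
  have C: "?C = ?A \<union> ?B" by (auto simp: cong_pairs_def)
  have "sum ?f ?C = sum ?f ?A + sum ?f ?B"
    by (subst C, rule sum.union_disjoint) (use fin in auto)
  also have "sum ?f ?B = sum ?f ?A"
    by (rule sum.reindex_bij_witness[of _ prod.swap prod.swap])
       (auto simp: cong_pairs_def cong_sym mult.commute)
  finally have 1: "sum ?f ?C = 2 * sum ?f ?A" by simp
  define i where "i = (\<lambda>(a, b). (gcd a b, a div gcd a b, b div gcd a b :: nat))"
  have inj: "inj_on i ?A"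
  proof (rule inj_onI, clarify)
    fix a b a' b' assume "(a, b) \<in> ?C" "(a', b') \<in> ?C" and eq: "i (a, b) = i (a', b')"
    hence "gcd a b = gcd a' b'" "a div gcd a b = a' div gcd a' b'" "b div gcd a b = b' div gcd a' b'"
      by (auto simp: i_def)
    hence "gcd a b * (a div gcd a b) = gcd a' b' * (a' div gcd a' b')"
      "gcd a b * (b div gcd a b) = gcd a' b' * (b' div gcd a' b')" by (simp_all only:)
    thus "a = a' \<and> b = b'" by simp
  qed
  have img: "i ` ?A \<subseteq> {1..M} \<times> ?R"
  proof (rule image_subsetI, clarify)
    fix a b assume ab: "(a, b) \<in> ?C" "b < a"
    define t u v where tuv: "t = gcd a b" "u = a div t" "v = b div t"
    have a: "a = t * u" and b: "b = t * v" by (simp_all add: tuv)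
    have ab': "a \<in> {1..M}" "b \<in> {1..M}" "\<not> p dvd a" "\<not> p dvd b" "[a ^ D = b ^ D] (mod p)"
      using ab by (auto simp: cong_pairs_def)
    have t: "t > 0" using ab' by (simp add: tuv)
    have uv: "u > 0" "v > 0" using ab' a b by (auto intro!: Nat.gr0I)
    have "coprime u v" unfolding tuv using ab' by (intro div_gcd_coprime) auto
    have tM: "t \<le> M" using ab' uv(1) a by (metis atLeastAtMost_iff dvd_imp_le dvd_triv_left le_trans less_le_trans zero_less_one)
    have uM: "u \<le> M" "v \<le> M" using ab' t a b
      by (metis atLeastAtMost_iff dvd_imp_le dvd_triv_right le_trans less_le_trans zero_less_one)+
    have pu: "\<not> p dvd u" "\<not> p dvd v" using ab' a b by auto
    have "coprime (t ^ D) p"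
    proof -
      have "\<not> p dvd t" using ab'(3) a by auto
      hence "coprime p (t ^ D)" using prime_imp_coprime[OF p] by (intro coprime_power_right_iff[THEN iffD2] disjI1)
      thus ?thesis by (simp add: coprime_commute)
    qed
    moreover have "[t ^ D * u ^ D = t ^ D * v ^ D] (mod p)"
      using ab'(5) by (simp add: a b power_mult_distrib)
    ultimately have "[u ^ D = v ^ D] (mod p)"
      using cong_mult_lcancel_nat[of "t ^ D" p "u ^ D" "v ^ D"] by blast
    moreover have "v < u" using ab(2) a b t by simp
    ultimately have "(u, v) \<in> ?R" using uv uM pu \<open>coprime u v\<close>
      by (auto simp: reduced_pairs_def cong_pairs_def)
    hence "(t, (u, v)) \<in> {1..M} \<times> ?R" using t tM by simp
    thus "i (a, b) \<in> {1..M} \<times> ?R" by (simp add: i_def tuv)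
  qed
  have "sum ?f ?A = (\<Sum>x\<in>?A. (\<lambda>(t, u, v). real t powr (-31/16) * (wt u * wt v)) (i x))"
  proof (rule sum.cong[OF refl], clarify)
    fix a b assume ab: "(a, b) \<in> ?C" "b < a"
    define t u v where tuv: "t = gcd a b" "u = a div t" "v = b div t"
    have a: "a = t * u" and b: "b = t * v" by (simp_all add: tuv)
    have "wt a * wt b = (wt t * wt t) * (wt u * wt v)" by (simp add: a b powr_mult)
    also have "wt t * wt t = real t powr (-31/16)" by (simp flip: powr_add)
    finally show "wt a * wt b = (\<lambda>(t, u, v). real t powr (-31/16) * (wt u * wt v)) (i (a, b))"
      by (simp add: i_def tuv)
  qed
  also have "\<dots> = (\<Sum>(t, u, v)\<in>i ` ?A. real t powr (-31/16) * (wt u * wt v))"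
    by (simp add: sum.reindex[OF inj])
  also have "\<dots> \<le> (\<Sum>(t, u, v)\<in>{1..M} \<times> ?R. real t powr (-31/16) * (wt u * wt v))"
    by (rule sum_mono2[OF _ img]) (auto simp: finite_reduced_pairs)
  also have "\<dots> = (\<Sum>t\<in>{1..M}. real t powr (-31/16)) * (\<Sum>(u, v)\<in>?R. wt u * wt v)"
    unfolding sum_product by (simp add: sum.cartesian_product case_prod_beta)
  finally show ?thesis using 1 by simp
qed

text \<open>Passing from G to \<plusminus>G costs nothing here, since totient (2 d) = totient d for
  odd \<open>d\<close>; the factor 1/2 comes from u + v \<le> 2 u.\<close>

lemma reduced_pairs_lower_bound:
  assumes "prime p" "odd d" "(u, v) \<in> reduced_pairs p (2 * d) M"
  shows "real p powr (1 / real (totient d)) / 2 \<le> real u"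
proof -
  have d: "d > 0" using assms(2) by (rule odd_pos)
  have uv: "u > 0" "v > 0" "v < u" "[u ^ (2 * d) = v ^ (2 * d)] (mod p)"
    using assms(3) by (auto simp: reduced_pairs_def cong_pairs_def)
  have "p \<le> (u + v) ^ totient (2 * d)"
    using power_cong_lower_bound[OF assms(1), of "2 * d" u v] uv d by simp
  also have "totient (2 * d) = totient d" using assms(2) by (simp add: totient_double)
  also have "(u + v) ^ totient d \<le> (2 * u) ^ totient d" using uv by (intro power_mono) auto
  finally have "real p \<le> (2 * real u) ^ totient d"
    by (metis of_nat_le_iff of_nat_mult of_nat_numeral of_nat_power)
  hence "real p powr (1 / real (totient d)) \<le> ((2 * real u) ^ totient d) powr (1 / real (totient d))"
    by (intro powr_mono2) auto
  also have "(2 * real u) ^ totient d = (2 * real u) powr real (totient d)"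
    using uv by (intro powr_realpow[symmetric]) simp
  also have "\<dots> powr (1 / real (totient d)) = 2 * real u"
    using uv d unfolding powr_powr by simp
  finally show ?thesis by simp
qed

text \<open>Numerators up to \<open>Z\<close> at least double from one pair to the next, so even the
  cruder weight 1 / sqrt u sums geometrically. With W = X / 2 this gives X^(-1/2), which is more
  than the X^(-1/4) aimed at.\<close>

lemma sum_reduced_small:
  fixes W :: real
  assumes p: "prime p" and D: "0 < D" "D < (K + 1) ^ 2" and Z: "Z ^ (2 * K) < p"
    and W: "W > 0" "\<And>u v. (u, v) \<in> reduced_pairs p D M \<Longrightarrow> W \<le> real u"
  shows "(\<Sum>(u, v)\<in>{(u, v) \<in> reduced_pairs p D M. u \<le> Z}. wt u * wt v) \<le> 4 / sqrt W"
proof -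
  let ?S = "{(u, v) \<in> reduced_pairs p D M. u \<le> Z}"
  have fin: "finite ?S" by (rule finite_subset[OF _ finite_reduced_pairs[of p D M]]) auto
  have "(\<Sum>(u, v)\<in>?S. wt u * wt v) \<le> (\<Sum>x\<in>?S. 1 / sqrt (real (fst x)))"
  proof (rule sum_mono, clarify)
    fix u v assume "(u, v) \<in> reduced_pairs p D M"
    hence uv: "u \<ge> 1" "v \<ge> 1" by (auto simp: reduced_pairs_def cong_pairs_def)
    have "wt u \<le> real u powr (-1/2)" using uv by (intro powr_mono) auto
    moreover have "wt v \<le> 1" using uv powr_mono[of "-31/32" 0 "real v"] by simp
    ultimately have "wt u * wt v \<le> real u powr (-1/2) * 1" by (intro mult_mono) auto
    also have "\<dots> = 1 / sqrt (real u)" using uv by (simp add: powr_minus_divide powr_half_sqrt)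
    finally show "wt u * wt v \<le> 1 / sqrt (real (fst (u, v)))" by simp
  qed
  also have "\<dots> \<le> 4 / sqrt W"
  proof (rule sum_inverse_sqrt_doubling[OF fin W(1)])
    fix x assume "x \<in> ?S" thus "W \<le> real (fst x)" using W(2) by auto
  next
    fix x y assume x: "x \<in> ?S" and y: "y \<in> ?S" and ne: "x \<noteq> y" and le: "real (fst x) \<le> real (fst y)"
    obtain u1 v1 u2 v2 where eq: "x = (u1, v1)" "y = (u2, v2)" by (cases x, cases y) blast
    have 1: "coprime u1 v1" "0 < v1" "v1 < u1" "u1 \<le> Z" "[u1 ^ D = v1 ^ D] (mod p)"
      and 2: "coprime u2 v2" "0 < v2" "v2 < u2" "u2 \<le> Z" "[u2 ^ D = v2 ^ D] (mod p)"
      using x y unfolding eq by (auto simp: reduced_pairs_def cong_pairs_def)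
    have "2 * u1 \<le> u2"
      using dependent_pairs_doubling[OF p D Z 1 2] le ne by (simp add: eq)
    hence "real (2 * u1) \<le> real u2" by (simp only: of_nat_le_iff)
    thus "2 * real (fst x) \<le> real (fst y)" by (simp add: eq)
  qed
  finally show ?thesis .
qed

lemma card_power_residues:
  fixes p D c :: nat
  assumes "prime p" "D > 0"
  shows "card {u. u < p \<and> [u ^ D = c] (mod p)} \<le> D"
proof -
  have "{u. u < p \<and> [u ^ D = c] (mod p)} = {x \<in> {..<p}. [x ^ D = c] (mod p)}" by auto
  thus ?thesis using roots_mod_prime_bound[OF assms, of c] by (simp only:)
qed

text \<open>Below \<open>p\<close> each \<open>v\<close> has at most \<open>D\<close> partners. The
  exponent of \<open>u\<close> is split as 31/32 = 5/8 + 11/32: the first part gives the power of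
  \<open>Y\<close>, the second is passed to \<open>v < u\<close>, where 11/32 + 31/32 = 21/16 > 1
  makes the sum converge.\<close>

lemma sum_reduced_medium:
  fixes Y :: real
  assumes p: "prime p" and D: "0 < D" and Y: "Y > 0"
  shows "(\<Sum>(u, v)\<in>{(u, v) \<in> reduced_pairs p D M. Y \<le> real u \<and> u < p}. wt u * wt v)
    \<le> real D * Y powr (-5/8) * (\<Sum>v\<in>{1..M}. real v powr (-21/16))"
proof -
  let ?S = "{(u, v) \<in> reduced_pairs p D M. Y \<le> real u \<and> u < p}"
  let ?U = "\<lambda>v. {u. u < p \<and> [u ^ D = v ^ D] (mod p)}"
  let ?T = "SIGMA v:{1..M}. ?U v"
  have fin: "finite (?U v)" for v by simp
  have "(\<Sum>(u, v)\<in>?S. wt u * wt v) \<le> (\<Sum>(u, v)\<in>?S. Y powr (-5/8) * real v powr (-21/16))"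
  proof (rule sum_mono, clarify)
    fix u v assume "(u, v) \<in> reduced_pairs p D M" and Yu: "Y \<le> real u"
    hence uv: "v \<ge> 1" "v < u" by (auto simp: reduced_pairs_def cong_pairs_def)
    have "wt u * wt v = real u powr (-5/8) * real u powr (-11/32) * wt v"
      by (simp flip: powr_add)
    also have "\<dots> \<le> Y powr (-5/8) * real v powr (-11/32) * wt v"
      using uv Y Yu by (intro mult_mono powr_mono2') auto
    also have "\<dots> = Y powr (-5/8) * real v powr (-21/16)"
      by (simp add: mult.assoc flip: powr_add)
    finally show "wt u * wt v \<le> Y powr (-5/8) * real v powr (-21/16)" .
  qed
  also have "\<dots> = (\<Sum>(v, u)\<in>prod.swap ` ?S. Y powr (-5/8) * real v powr (-21/16))"
    by (subst sum.reindex) (auto simp: case_prod_beta)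
  also have "\<dots> \<le> (\<Sum>(v, u)\<in>?T. Y powr (-5/8) * real v powr (-21/16))"
    by (rule sum_mono2) (auto simp: reduced_pairs_def cong_pairs_def)
  also have "\<dots> = (\<Sum>v\<in>{1..M}. \<Sum>u\<in>?U v. Y powr (-5/8) * real v powr (-21/16))"
    by (subst sum.Sigma) auto
  also have "\<dots> \<le> (\<Sum>v\<in>{1..M}. real D * (Y powr (-5/8) * real v powr (-21/16)))"
  proof (rule sum_mono)
    fix v
    have "(\<Sum>u\<in>?U v. Y powr (-5/8) * real v powr (-21/16)) =
       real (card (?U v)) * (Y powr (-5/8) * real v powr (-21/16))" by simp
    also have "\<dots> \<le> real D * (Y powr (-5/8) * real v powr (-21/16))"
      using card_power_residues[OF p D, of "v ^ D"] by (intro mult_right_mono) auto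
    finally show "(\<Sum>u\<in>?U v. Y powr (-5/8) * real v powr (-21/16))
       \<le> real D * (Y powr (-5/8) * real v powr (-21/16))" .
  qed
  also have "\<dots> = real D * Y powr (-5/8) * (\<Sum>v\<in>{1..M}. real v powr (-21/16))"
    by (simp add: sum_distrib_left mult_ac)
  finally show ?thesis .
qed

text \<open>Write u = k p + r with k \<ge> 1. For given \<open>v\<close> there are at most
  \<open>D\<close> values of \<open>r\<close>, and 1 / u \<le> 1 / (p k). Since n \<le> p^4, each
  weight is at most p^(1/8) / n, so two of them cost p^(1/4) out of the gain 1 / p.\<close>

lemma sum_reduced_large:
  fixes p :: nat
  assumes p: "prime p" and D: "0 < D"
  shows "(\<Sum>(u, v)\<in>{(u, v) \<in> reduced_pairs p D (p ^ 4). p \<le> u}. wt u * wt v)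
    \<le> real p powr (-3/4) * real D * (\<Sum>n\<in>{1..p ^ 4}. 1 / real n) ^ 2"
proof -
  let ?M = "p ^ 4"
  let ?S = "{(u, v) \<in> reduced_pairs p D ?M. p \<le> u}"
  let ?U = "\<lambda>v. {u. u < p \<and> [u ^ D = v ^ D] (mod p)}"
  let ?T = "SIGMA v:{1..?M}. {1..?M} \<times> ?U v"
  have p0: "p > 0" using prime_gt_0_nat[OF p] .
  define i where "i = (\<lambda>(u, v). (v :: nat, u div p, u mod p))"
  have inj: "inj_on i ?S"
    unfolding inj_on_def i_def by (auto simp: case_prod_beta) (metis div_mult_mod_eq)
  have wt_le: "wt n \<le> real p powr (1/8) / real n" if "n \<in> {1..?M}" for n
  proof -
    have "real n powr (1/32) \<le> real ?M powr (1/32)"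
      using that by (intro powr_mono2) (auto simp flip: of_nat_power)
    also have "real ?M = real p powr 4" using p0 by simp
    also have "\<dots> powr (1/32) = real p powr (1/8)" unfolding powr_powr by simp
    finally have "real n powr (1/32) * real n powr (-1) \<le> real p powr (1/8) * real n powr (-1)"
      by (rule mult_right_mono) simp
    moreover have "real n powr (1/32) * real n powr (-1) = wt n" by (subst powr_add[symmetric]) simp
    moreover have "real n powr (-1) = 1 / real n" using that by (simp add: powr_minus_divide)
    ultimately show ?thesis by simp
  qed
  have "(\<Sum>(u, v)\<in>?S. wt u * wt v) \<le> (\<Sum>x\<in>?S. (\<lambda>(v, k, r). real p powr (-3/4) * (1 / real v) * (1 / real k)) (i x))"
  proof (rule sum_mono, clarify)
    fix u v assume "(u, v) \<in> reduced_pairs p D ?M" and pu: "p \<le> u"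
    hence uv: "v \<in> {1..?M}" "u \<in> {1..?M}" by (auto simp: reduced_pairs_def cong_pairs_def)
    have k: "u div p \<ge> 1" using pu p0 by (simp add: div_greater_zero_iff Suc_leI)
    have "real p * real (u div p) \<le> real u"
      by (metis of_nat_le_iff of_nat_mult times_div_less_eq_dividend)
    hence "1 / real u \<le> 1 / (real p * real (u div p))"
      using k p0 uv(2) by (intro divide_left_mono) (auto intro!: mult_pos_pos simp del: of_nat_div)
    have "wt u * wt v \<le> (real p powr (1/8) / real u) * (real p powr (1/8) / real v)"
      using wt_le[OF uv(1)] wt_le[OF uv(2)] by (intro mult_mono) auto
    also have "\<dots> = real p powr (1/4) * (1 / real v) * (1 / real u)"
      by (simp flip: powr_add)
    also have "\<dots> \<le> real p powr (1/4) * (1 / real v) * (1 / (real p * real (u div p)))"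
      using \<open>1 / real u \<le> _\<close> by (intro mult_left_mono) auto
    also have "real p powr (1/4) = real p powr (-3/4) * real p" 
      using p0 by (simp add: powr_mult_base mult.commute)
    also have "real p powr (-3/4) * real p * (1 / real v) * (1 / (real p * real (u div p)))
      = real p powr (-3/4) * (1 / real v) * (1 / real (u div p))" using p0 by simp
    finally show "wt u * wt v \<le> (\<lambda>(v, k, r). real p powr (-3/4) * (1 / real v) * (1 / real k)) (i (u, v))"
      by (simp add: i_def)
  qed
  also have "\<dots> = (\<Sum>(v, k, r)\<in>i ` ?S. real p powr (-3/4) * (1 / real v) * (1 / real k))"
    by (simp add: sum.reindex[OF inj])
  also have "\<dots> \<le> (\<Sum>(v, k, r)\<in>?T. real p powr (-3/4) * (1 / real v) * (1 / real k))"
  proof (rule sum_mono2)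
    show "i ` ?S \<subseteq> ?T"
    proof (rule image_subsetI, clarify)
      fix u v assume "(u, v) \<in> reduced_pairs p D ?M" and pu: "p \<le> u"
      hence uv: "v \<in> {1..?M}" "u \<in> {1..?M}" "[u ^ D = v ^ D] (mod p)"
        by (auto simp: reduced_pairs_def cong_pairs_def)
      have "u div p \<ge> 1" using pu p0 by (simp add: div_greater_zero_iff Suc_leI)
      moreover have "u div p \<le> ?M" using uv(2) div_le_dividend[of u p] by (meson atLeastAtMost_iff order_trans)
      moreover have "[(u mod p) ^ D = u ^ D] (mod p)" by (intro cong_pow) simp
      ultimately show "i (u, v) \<in> ?T" using uv p0 cong_trans by (auto simp: i_def)
    qed
  qed auto
  also have "\<dots> = (\<Sum>v\<in>{1..?M}. \<Sum>(k, r)\<in>{1..?M} \<times> ?U v. real p powr (-3/4) * (1 / real v) * (1 / real k))"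
    by (subst sum.Sigma) auto
  also have "\<dots> = (\<Sum>v\<in>{1..?M}. \<Sum>k\<in>{1..?M}. \<Sum>r\<in>?U v. real p powr (-3/4) * (1 / real v) * (1 / real k))"
    by (intro sum.cong refl sum.cartesian_product[symmetric])
  also have "\<dots> \<le> (\<Sum>v\<in>{1..?M}. \<Sum>k\<in>{1..?M}. real D * (real p powr (-3/4) * (1 / real v) * (1 / real k)))"
  proof (intro sum_mono)
    fix v k
    have "(\<Sum>r\<in>?U v. real p powr (-3/4) * (1 / real v) * (1 / real k)) =
       real (card (?U v)) * (real p powr (-3/4) * (1 / real v) * (1 / real k))" by simp
    also have "\<dots> \<le> real D * (real p powr (-3/4) * (1 / real v) * (1 / real k))"
      using card_power_residues[OF p D, of "v ^ D"] by (intro mult_right_mono) auto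
    finally show "(\<Sum>r\<in>?U v. real p powr (-3/4) * (1 / real v) * (1 / real k))
       \<le> real D * (real p powr (-3/4) * (1 / real v) * (1 / real k))" .
  qed
  also have "\<dots> = real p powr (-3/4) * real D * (\<Sum>n\<in>{1..?M}. 1 / real n) ^ 2"
    by (simp add: power2_eq_square sum_product sum_distrib_left mult_ac)
  finally show ?thesis .
qed

section \<open>Elementary bounds for harmonic and power sums\<close>

lemma harmonic_le: "(\<Sum>k<n. 1 / real (Suc k)) \<le> 1 + ln (real (max n 1))"
proof (induction n)
  case (Suc n)
  show ?case
  proof (cases "n = 0")
    case False
    have "ln (real n / real (Suc n)) \<le> real n / real (Suc n) - 1" using False by (intro ln_le_minus_one) auto
    also have "\<dots> = - (1 / real (Suc n))" by (simp add: field_simps)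
    finally have "1 / real (Suc n) \<le> ln (real (Suc n)) - ln (real n)" using False by (simp add: ln_div)
    thus ?thesis using Suc False by simp
  qed simp
qed simp

lemma summable_powr_nat:
  fixes s :: real
  assumes "s < -1"
  shows "summable (\<lambda>n. real n powr s)"
  using assms summable_real_powr_iff[of s] by simp

lemma sum_powr_le_suminf:
  fixes s :: real
  assumes "s < -1"
  shows "(\<Sum>n\<in>{1..M}. real n powr s) \<le> (\<Sum>n. real n powr s)"
  by (rule sum_le_suminf[OF summable_powr_nat[OF assms]]) auto

lemma sum_union_le:
  fixes f :: "'a \<Rightarrow> real"
  assumes "finite A" "finite B" "\<And>x. 0 \<le> f x" "R \<subseteq> A \<union> B"
  shows "sum f R \<le> sum f A + sum f B"
proof -
  have "sum f R \<le> sum f (A \<union> B)" using assms by (intro sum_mono2) auto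
  also have "\<dots> = sum f A + sum f B - sum f (A \<inter> B)" by (rule sum_Un) (use assms in auto)
  also have "sum f (A \<inter> B) \<ge> 0" by (intro sum_nonneg assms)
  hence "sum f A + sum f B - sum f (A \<inter> B) \<le> sum f A + sum f B" by simp
  finally show ?thesis .
qed

text \<open>The numerators are split into small, medium and large ones, and the three summands of
  the constant belong to these ranges in this order.\<close>

lemma sum_reduced_bound:
  fixes p d :: nat
  assumes p: "prime p" and d: "odd d" and le: "real (totient d) \<le> ln (real p)"
  defines "\<zeta> \<equiv> \<Sum>n. real n powr (-21/16)"
  shows "(\<Sum>(u, v)\<in>reduced_pairs p (2 * d) (p ^ 4). wt u * wt v)
     \<le> (8 + 4 * 256 ^ 8 * \<zeta> + 409600) * real p powr (-1 / (4 * real (totient d)))"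
proof -
  define R where "R = reduced_pairs p (2 * d) (p ^ 4)"
  define f where "f = (\<lambda>(u, v). wt u * wt v)"
  define \<phi> where "\<phi> = real (totient d)"
  \<comment> \<open>In these units p = exp(l \<phi>), X = exp l, and the target is
    exp(-l/4).\<close>
  define l where "l = ln (real p) / \<phi>"
  define q where "q = \<phi> powr (1/4)"
  have d0: "d > 0" using d by (rule odd_pos)
  have p0: "p > 0" using prime_gt_0_nat[OF p] .
  have \<phi>1: "\<phi> \<ge> 1" using d0 by (simp add: \<phi>_def Suc_leI)
  have le': "\<phi> \<le> ln (real p)" using le by (simp add: \<phi>_def)
  have l1: "l \<ge> 1" using le' \<phi>1 by (simp add: l_def le_divide_eq)
  have q1: "q \<ge> 1" using \<phi>1 by (simp add: q_def ge_one_powr_ge_zero)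
  have q4: "q ^ 4 = \<phi>" using \<phi>1 by (simp add: q_def powr_power)
  have L: "ln (real p) = l * \<phi>" using \<phi>1 by (simp add: l_def)
  have pexp: "real p = exp (l * \<phi>)" using p0 L by (metis exp_ln of_nat_0_less_iff)
  have pp: "real p powr s = exp (s * (l * \<phi>))" for s using p0 by (simp add: powr_def L)
  have X: "real p powr (1 / \<phi>) = exp l" unfolding pp using \<phi>1 by simp
  have target: "real p powr (-1 / (4 * real (totient d))) = exp (-l / 4)"
    unfolding pp \<phi>_def[symmetric] using \<phi>1 by simp
  have \<zeta>0: "\<zeta> \<ge> 0" unfolding \<zeta>_def by (intro suminf_nonneg summable_powr_nat) auto
  have f0: "0 \<le> f x" for x by (simp add: f_def case_prod_beta)
  have finR: "finite R" by (simp add: R_def finite_reduced_pairs)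
  have low: "exp l / 2 \<le> real u" if "(u, v) \<in> R" for u v
    using reduced_pairs_lower_bound[OF p d, of u v "p ^ 4"] that X by (simp add: R_def \<phi>_def)
  have d\<phi>: "(real d) ^ 2 \<le> 2 * \<phi> ^ 3"
  proof -
    have "real (d ^ 2) \<le> real (2 * totient d ^ 3)"
      using odd_square_le_totient_cubed[OF d] by (simp only: of_nat_le_iff)
    thus ?thesis by (simp add: \<phi>_def)
  qed
  have d2: "real d \<le> 2 * \<phi> ^ 2"
  proof (rule power2_le_imp_le)
    have "\<phi> ^ 3 \<le> \<phi> ^ 4" "0 \<le> \<phi> ^ 4" using \<phi>1 by (auto intro: power_increasing)
    hence "2 * \<phi> ^ 3 \<le> 4 * \<phi> ^ 4" by linarith
    thus "(real d) ^ 2 \<le> (2 * \<phi> ^ 2) ^ 2" using d\<phi> by (simp add: power_mult_distrib flip: power_mult)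
  qed (use \<phi>1 in auto)

  \<comment> \<open>As \<phi> \<le> ln p, the factor 2 d is at most 4 (ln p)^2, and the harmonic
    sums give two more logarithms. Bounding (ln p)^4 by (8 p^(1/8))^4 costs p^(1/2) and leaves
    p^(-1/4); the constant is 100 * 8^4.\<close>
  have large: "sum f {(u, v) \<in> R. p \<le> u} \<le> 409600 * exp (-l / 4)"
  proof -
    define H where "H = (\<Sum>n\<in>{1..p ^ 4}. 1 / real n)"
    have "H = (\<Sum>k<p ^ 4. 1 / real (Suc k))" unfolding H_def
      by (rule sum.reindex_bij_witness[of _ Suc "\<lambda>n. n - 1"]) auto
    also have "\<dots> \<le> 1 + ln (real (max (p ^ 4) 1))" by (rule harmonic_le)
    also have "max (p ^ 4) 1 = p ^ 4" using p0 by (intro max_absorb1 one_le_power) simp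
    also have "ln (real (p ^ 4)) = 4 * ln (real p)" using p0 by (simp add: ln_realpow)
    finally have H: "H \<le> 5 * ln (real p)" using le \<phi>1 by (simp add: \<phi>_def)
    have H0: "H \<ge> 0" by (auto simp: H_def intro: sum_nonneg)
    have lnp: "0 \<le> ln (real p)" "ln (real p) \<le> 8 * real p powr (1/8)"
      using le \<phi>1 ln_powr_bound[of "real p" "1/8"] p0 by (auto simp: \<phi>_def)
    have "sum f {(u, v) \<in> R. p \<le> u} \<le> real p powr (-3/4) * real (2 * d) * H ^ 2"
      using sum_reduced_large[OF p, of "2 * d"] d0 unfolding R_def f_def H_def by simp
    also have "\<dots> \<le> real p powr (-3/4) * (4 * ln (real p) ^ 2) * (5 * ln (real p)) ^ 2"
    proof (intro mult_mono power_mono H)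
      have "\<phi> ^ 2 \<le> ln (real p) ^ 2" using le \<phi>1 by (intro power_mono) (auto simp: \<phi>_def)
      thus "real (2 * d) \<le> 4 * ln (real p) ^ 2" using d2 by simp
    qed (use H0 in auto)
    also have "\<dots> = 100 * real p powr (-3/4) * ln (real p) ^ 4" by (simp add: eval_nat_numeral)
    also have "\<dots> \<le> 100 * real p powr (-3/4) * (8 * real p powr (1/8)) ^ 4"
      using lnp by (intro mult_left_mono power_mono) auto
    also have "\<dots> = 409600 * (real p powr (-3/4) * (real p powr (1/8)) ^ 4)" by (simp add: power_mult_distrib)
    also have "(real p powr (1/8)) ^ 4 = real p powr (1/2)"
      using p0 by (simp add: powr_power)
    also have "real p powr (-3/4) * real p powr (1/2) = exp (-(l * \<phi>) / 4)"
      unfolding pp exp_add[symmetric] by (rule arg_cong[of _ _ exp]) (simp add: field_simps)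
    also have "\<dots> \<le> exp (-l / 4)" using l1 \<phi>1 by simp
    finally show ?thesis by simp
  qed

  have medium: "sum f {(u, v) \<in> R. y \<le> real u \<and> u < p} \<le> 2 * real d * y powr (-5/8) * \<zeta>" if "y > 0" for y
  proof -
    have "sum f {(u, v) \<in> R. y \<le> real u \<and> u < p} \<le> real (2 * d) * y powr (-5/8) * (\<Sum>v\<in>{1..p ^ 4}. real v powr (-21/16))"
      unfolding f_def R_def using sum_reduced_medium[OF p, of "2 * d" y] d0 that by simp
    also have "\<dots> \<le> real (2 * d) * y powr (-5/8) * \<zeta>"
      unfolding \<zeta>_def by (intro mult_left_mono sum_powr_le_suminf) auto
    finally show ?thesis by simp
  qed

  have fin: "finite {(u, v) \<in> R. P u v}" for P by (rule finite_subset[OF _ finR]) auto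

  have "sum f R \<le> (8 + 4 * 256 ^ 8 * \<zeta> + 409600) * exp (-l / 4)"
  \<comment> \<open>The threshold is 4^4, so the second case has q \<ge> 4. In the first case d
    \<le> 2 * 256^2 is absorbed in the constant, and the medium range can begin at the lower bound X
    / 2.\<close>
  proof (cases "\<phi> < 256")
    case True
    define y where "y = exp l / 2"
    have y: "y > 0" by (simp add: y_def)
    have "y powr (-5/8) = exp (-5/8 * (l - ln 2))"
      by (simp add: y_def powr_def ln_div)
    also have "\<dots> = exp (-5/8 * l) * 2 powr (5/8)"
      by (simp add: powr_def right_diff_distrib flip: exp_add)
    also have "\<dots> \<le> exp (-l / 4) * 2 powr 1"
      using l1 by (intro mult_mono powr_mono) auto
    finally have y58: "y powr (-5/8) \<le> 2 * exp (-l / 4)" by simp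
    have "\<phi> ^ 2 \<le> 256 ^ 2" using True \<phi>1 by (intro power_mono) auto
    hence d256: "real d \<le> 2 * 256 ^ 2" using d2 by simp
    have "R \<subseteq> {(u, v) \<in> R. y \<le> real u \<and> u < p} \<union> {(u, v) \<in> R. p \<le> u}"
      using low by (auto simp: y_def not_le)
    hence "sum f R \<le> sum f {(u, v) \<in> R. y \<le> real u \<and> u < p} + sum f {(u, v) \<in> R. p \<le> u}"
      by (rule sum_union_le[OF fin fin f0])
    also have "\<dots> \<le> 2 * real d * y powr (-5/8) * \<zeta> + 409600 * exp (-l / 4)"
      by (intro add_mono medium large y)
    finally have split: "sum f R \<le> 2 * real d * y powr (-5/8) * \<zeta> + 409600 * exp (-l / 4)" .
    have "2 * real d * y powr (-5/8) * \<zeta> \<le> 2 * (2 * 256 ^ 2) * (2 * exp (-l / 4)) * \<zeta>"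
      using y58 d256 \<zeta>0 by (intro mult_right_mono mult_mono) auto
    also have "\<dots> \<le> 4 * 256 ^ 8 * \<zeta> * exp (-l / 4)" using \<zeta>0 by (simp add: mult_right_mono)
    finally have "sum f R \<le> 4 * 256 ^ 8 * \<zeta> * exp (-l / 4) + 409600 * exp (-l / 4)"
      using split by linarith
    also have "\<dots> \<le> (8 + 4 * 256 ^ 8 * \<zeta> + 409600) * exp (-l / 4)"
      unfolding distrib_right by simp
    finally show ?thesis .
  next
    case False
    hence "4 ^ 4 \<le> q ^ 4" unfolding q4 by simp
    hence q: "q \<ge> 4" using q1 by (intro power_le_imp_le_base[of 4 3 q]) auto
    txt \<open>The factor \<open>1/5\<close> keeps solutions below \<open>y\<close> within reach of the dependence argument, since \<open>K < 2 * q ^ 3\<close> and hence \<open>y ^ (2 * K) < exp (l * q ^ 4) = p\<close>.\<close>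
    define y where "y = exp (l * q / 5)"
    define Z where "Z = nat \<lfloor>y\<rfloor>"
    define K where "K = nat \<lfloor>sqrt (real (2 * d))\<rfloor>"
    have y: "y > 0" by (simp add: y_def)
    have KD: "2 * d < (K + 1) ^ 2"
    proof -
      have "sqrt (real (2 * d)) < real (K + 1)" unfolding K_def by simp linarith
      hence "sqrt (real (2 * d)) ^ 2 < real (K + 1) ^ 2" by (intro power_strict_mono) auto
      hence "real (2 * d) < real ((K + 1) ^ 2)" by simp
      thus ?thesis by (simp only: of_nat_less_iff)
    qed
    have Kle: "real K \<le> sqrt (real (2 * d))" unfolding K_def by simp
    \<comment> \<open>Fourth powers bring in d^2 \<le> 2 \<phi>^3 directly: K^4 \<le> 4 d^2 \<le> 8
      \<phi>^3, where \<phi>^3 = q^12.\<close>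
    have "real K ^ 4 \<le> sqrt (real (2 * d)) ^ 4" using Kle by (intro power_mono) auto
    also have "\<dots> = (sqrt (real (2 * d)) ^ 2) ^ 2" unfolding power_mult[symmetric] by simp
    also have "\<dots> = 4 * real d ^ 2" by (simp add: power_mult_distrib)
    also have "\<dots> \<le> 8 * \<phi> ^ 3" using d\<phi> by simp
    also have "\<dots> < 16 * \<phi> ^ 3" using \<phi>1 by simp
    also have "\<dots> = (2 * q ^ 3) ^ 4" by (simp add: power_mult_distrib flip: q4 power_mult)
    finally have K4: "real K ^ 4 < (2 * q ^ 3) ^ 4" .
    have K: "real K < 2 * q ^ 3" using power_less_imp_less_base[OF K4] q1 by simp
    have "real (Z ^ (2 * K)) \<le> y ^ (2 * K)"
      unfolding of_nat_power using y by (intro power_mono) (auto simp: Z_def)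
    also have "\<dots> = exp (real (2 * K) * (l * q / 5))" unfolding y_def by (rule exp_of_nat_mult[symmetric])
    also have "\<dots> < exp (l * \<phi>)"
    proof -
      have "real (2 * K) * (l * q / 5) = (2 * l * q / 5) * real K" by simp
      also have "\<dots> < (2 * l * q / 5) * (2 * q ^ 3)"
        using K l1 q1 by (intro mult_strict_left_mono) auto
      also have "\<dots> = 4 / 5 * (l * \<phi>)" by (simp add: eval_nat_numeral flip: q4)
      also have "\<dots> < l * \<phi>" using l1 \<phi>1 by simp
      finally show ?thesis by simp
    qed
    finally have ZK: "Z ^ (2 * K) < p" unfolding pexp[symmetric] by (simp only: of_nat_less_iff)
    have small: "sum f {(u, v) \<in> R. u \<le> Z} \<le> 8 * exp (-l / 4)"
    proof -
      have "sum f {(u, v) \<in> R. u \<le> Z} \<le> 4 / sqrt (exp l / 2)"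
        unfolding f_def R_def
        by (rule sum_reduced_small[OF p _ KD ZK]) (use d0 low in \<open>auto simp: R_def\<close>)
      also have "\<dots> = 4 * sqrt 2 * exp (-l / 2)"
      proof -
        have "sqrt (exp l) = exp (l / 2)"
          by (rule real_sqrt_unique) (simp_all flip: exp_of_nat_mult)
        thus ?thesis by (simp add: real_sqrt_divide exp_minus field_simps)
      qed
      also have "\<dots> \<le> 4 * 2 * exp (-l / 4)"
        using l1 by (intro mult_mono) (auto intro: real_le_lsqrt)
      finally show ?thesis by simp
    qed
    have med: "2 * real d * y powr (-5/8) * \<zeta> \<le> 4 * 256 ^ 8 * \<zeta> * exp (-l / 4)"
    proof -
      have "y powr (-5/8) = exp (- (l * q / 8))" by (simp add: y_def powr_def)
      also have "\<dots> \<le> exp (- l / 4 - q / 16)"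
      proof -
        \<comment> \<open>Half of l q / 8 pays for the decay l / 4, because q \<ge> 4; the other
          half leaves q / 16, because l \<ge> 1.\<close>
        have "4 * l \<le> l * q" "q \<le> l * q" using q l1 by (simp_all add: mult.commute)
        thus ?thesis by simp
      qed
      also have "\<dots> = exp (-l / 4) * inverse (exp (q / 16))"
        unfolding exp_diff by (rule divide_inverse)
      also have "\<dots> \<le> exp (-l / 4) * inverse ((q / 256) ^ 8)"
      proof -
        \<comment> \<open>The spare exp(q / 16) is turned into an eighth power of \<open>q\<close>
          in order to absorb d \<le> 2 q^8; this produces the constant 256^8.\<close>
        have "q / 256 \<le> exp (q / 128)" using exp_ge_add_one_self[of "q / 128"] q1 by linarith
        hence "(q / 256) ^ 8 \<le> exp (q / 128) ^ 8" using q1 by (intro power_mono) auto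
        also have "\<dots> = exp (q / 16)" by (simp flip: exp_of_nat_mult)
        finally show ?thesis using q1 by (intro mult_left_mono le_imp_inverse_le) auto
      qed
      finally have y58: "y powr (-5/8) \<le> exp (-l / 4) * inverse ((q / 256) ^ 8)" .
      have dq: "real d \<le> 2 * q ^ 8" using d2 by (simp flip: q4 power_mult)
      have "2 * real d * y powr (-5/8) * \<zeta> \<le> 2 * (2 * q ^ 8) * (exp (-l / 4) * inverse ((q / 256) ^ 8)) * \<zeta>"
        using y58 dq \<zeta>0 by (intro mult_right_mono mult_mono) auto
      also have "\<dots> = 4 * 256 ^ 8 * \<zeta> * exp (-l / 4)"
        using q1 by (simp add: power_divide field_simps)
      finally show ?thesis .
    qed
    have "R \<subseteq> {(u, v) \<in> R. u \<le> Z} \<union> ({(u, v) \<in> R. y \<le> real u \<and> u < p} \<union> {(u, v) \<in> R. p \<le> u})"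
    proof (clarify, goal_cases)
      case (1 u v)
      have "y \<le> real u" if "Z < u" using that y unfolding Z_def by linarith
      thus ?case using 1 by auto
    qed
    hence "sum f R \<le> sum f {(u, v) \<in> R. u \<le> Z}
        + sum f ({(u, v) \<in> R. y \<le> real u \<and> u < p} \<union> {(u, v) \<in> R. p \<le> u})"
      by (rule sum_union_le[OF fin finite_UnI[OF fin fin] f0])
    also have "\<dots> \<le> 8 * exp (-l / 4) + (2 * real d * y powr (-5/8) * \<zeta> + 409600 * exp (-l / 4))"
      by (intro add_mono small order_trans[OF sum_union_le[OF fin fin f0 order_refl]] medium large y)
    also have "\<dots> \<le> (8 + 4 * 256 ^ 8 * \<zeta> + 409600) * exp (-l / 4)"
      using med by (simp add: algebra_simps)
    finally show ?thesis .
  qed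
  thus ?thesis unfolding target R_def f_def .
qed

section \<open>Odd characters trivial on the subgroup of order \<open>d\<close>\<close>

text \<open>Multiplication by \<open>w\<close> permutes \<open>A\<close> and scales the sum by w^k,
  which differs from 1.\<close>

lemma sum_powers_eq_0:
  fixes A :: "complex set"
  assumes "w \<noteq> 0" "w ^ k \<noteq> 1" "\<And>z. w * z \<in> A \<longleftrightarrow> z \<in> A"
  shows "(\<Sum>z\<in>A. z ^ k) = 0"
proof -
  have "bij_betw (\<lambda>z. w * z) A A"
  proof (rule bij_betw_byWitness[where f' = "\<lambda>z. z / w"])
    show "(\<lambda>z. z / w) ` A \<subseteq> A" using assms(1) assms(3)[of "z / w" for z] by auto
  qed (use assms in auto)
  hence "(\<Sum>z\<in>A. (w * z) ^ k) = (\<Sum>z\<in>A. z ^ k)" by (rule sum.reindex_bij_betw)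
  hence "w ^ k * (\<Sum>z\<in>A. z ^ k) = (\<Sum>z\<in>A. z ^ k)"
    by (simp add: power_mult_distrib sum_distrib_left)
  thus ?thesis using assms by simp
qed

lemma roots_minus_one:
  assumes "h > 0"
  shows "finite {z::complex. z ^ h = -1}" "card {z::complex. z ^ h = -1} = h"
proof -
  define w where "w = cis (pi / real h)"
  have "w ^ h = cis (real h * (pi / real h))" unfolding w_def by (rule Complex.DeMoivre)
  hence w: "w ^ h = -1" "w \<noteq> 0" using assms by (simp_all add: w_def)
  have "bij_betw (\<lambda>z. w * z) {z. z ^ h = 1} {z. z ^ h = -1}"
    by (rule bij_betw_byWitness[where f' = "\<lambda>z. z / w"])
       (use w in \<open>auto simp: power_mult_distrib power_divide\<close>)
  thus "finite {z::complex. z ^ h = -1}" "card {z::complex. z ^ h = -1} = h"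
    using card_roots_unity_eq[OF assms] finite_roots_unity[of h] assms
    by (auto simp: bij_betw_same_card[symmetric] bij_betw_finite[symmetric])
qed

section \<open>The cyclic group \<open>Fp_star p\<close> and its subgroup of index
  \<open>m\<close>\<close>

locale odd_order_subgroup =
  fixes p m d :: nat
  assumes prime_p: "prime p" and p_gt_2: "p > 2" and p_minus_1: "p - 1 = d * m" and odd_d: "odd d"
begin

lemma d_pos: "d > 0" and m_pos: "m > 0"
  using p_minus_1 p_gt_2 by (auto intro!: Nat.gr0I)

lemma Fp_star_simps:
  "carrier (Fp_star p) = {1..int p - 1}"
  "x \<otimes>\<^bsub>Fp_star p\<^esub> y = x * y mod int p"
  "\<one>\<^bsub>Fp_star p\<^esub> = 1"
proof -
  interpret residues_prime p "residue_ring (int p)"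
    by unfold_locales (use prime_p in auto)
  show "carrier (Fp_star p) = {1..int p - 1}"
    using res_prime_units_eq p_gt_2 by (simp add: Fp_star_def units_of_carrier of_nat_diff)
  show "x \<otimes>\<^bsub>Fp_star p\<^esub> y = x * y mod int p"
    by (simp add: Fp_star_def units_of_mult res_mult_eq)
  show "\<one>\<^bsub>Fp_star p\<^esub> = 1"
    by (simp add: Fp_star_def units_of_one res_one_eq)
qed

sublocale Fp: comm_group "Fp_star p"
proof -
  interpret residues_prime p "residue_ring (int p)"
    by unfold_locales (use prime_p in auto)
  show "comm_group (Fp_star p)" unfolding Fp_star_def by (rule units_comm_group)
qed

lemma Fp_star_pow: "x [^]\<^bsub>Fp_star p\<^esub> (n::nat) = x ^ n mod int p"
proof (induction n)
  case 0
  thus ?case using p_gt_2 by (simp add: Fp_star_simps)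
next
  case (Suc n)
  thus ?case by (simp add: Fp_star_simps mod_mult_right_eq mult.commute)
qed

definition g :: nat where "g = (SOME g. residue_primroot p g)"

lemma g: "residue_primroot p g"
  unfolding g_def by (rule someI_ex) (use prime_primitive_root_exists[of p] prime_p p_gt_2 in auto)

lemma ord_g: "ord p g = p - 1" and coprime_g: "coprime p g"
  using g totient_prime[OF prime_p] by (auto simp: residue_primroot_def)

lemma g_bij: "bij_betw (\<lambda>i. g ^ i mod p) {..<p - 1} {0<..<p}"
  using residue_primroot_is_generator[OF _ g] p_gt_2
  by (simp add: totient_prime[OF prime_p] totatives_prime[OF prime_p])

lemma g_pow_cong: "[g ^ i = g ^ j] (mod p) \<longleftrightarrow> [i = j] (mod (p - 1))"
  using order_divides_expdiff[of p g i j] coprime_g by (simp add: ord_g)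

lemma g_pow_mod: "0 < g ^ k mod p" "g ^ k mod p < p"
proof -
  have "coprime p (g ^ k)" using coprime_g by simp
  hence "\<not> p dvd g ^ k" using prime_p coprime_absorb_left not_prime_unit by blast
  thus "0 < g ^ k mod p" by (simp add: mod_greater_zero_iff_not_dvd)
  show "g ^ k mod p < p" using p_gt_2 by simp
qed

lemma g_log:
  assumes "\<not> p dvd a"
  obtains i where "i < p - 1" "a mod p = g ^ i mod p"
proof -
  have "a mod p \<in> {0<..<p}" using assms p_gt_2 by (auto simp: mod_greater_zero_iff_not_dvd)
  also have "{0<..<p} = (\<lambda>i. g ^ i mod p) ` {..<p - 1}"
    using bij_betw_imp_surj_on[OF g_bij] by simp
  finally show ?thesis using that by blast
qed

lemma g_pow_mod_eqD: "g ^ i mod p = g ^ j mod p \<Longrightarrow> i < p - 1 \<Longrightarrow> j < p - 1 \<Longrightarrow> i = j"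
  using inj_onD[OF bij_betw_imp_inj_on[OF g_bij]] by blast

text \<open>As \<open>d\<close> is odd, the even number p - 1 = d m forces \<open>m\<close> to be
  even. The exponent is then (p - 1) / 2, and that power of a primitive root squares to 1 without
  being 1.\<close>

lemma g_pow_half: "[g ^ (m div 2 * d) = p - 1] (mod p)" and m_even: "even m"
proof -
  have "odd p" using prime_p p_gt_2 prime_odd_nat by auto
  hence "even (d * m)" unfolding p_minus_1[symmetric] by simp
  thus m: "even m" using odd_d by simp
  hence e: "m div 2 * d * 2 = p - 1" using p_minus_1 by auto
  let ?x = "int (g ^ (m div 2 * d))"
  have "[g ^ (m div 2 * d * 2) = g ^ 0] (mod p)" unfolding e g_pow_cong by (simp add: Cong.cong_0_iff)
  hence "[?x ^ 2 = 1] (mod int p)"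
    by (metis cong_int_iff of_nat_power power_mult power_0 of_nat_1)
  hence "int p dvd (?x - 1) * (?x + 1)"
    by (simp add: cong_iff_dvd_diff power2_eq_square algebra_simps)
  hence "int p dvd ?x - 1 \<or> int p dvd ?x + 1"
    using prime_p by (simp add: prime_dvd_mult_iff)
  moreover have "\<not> int p dvd ?x - 1"
  proof
    assume "int p dvd ?x - 1"
    hence "[?x = 1] (mod int p)" by (simp add: cong_iff_dvd_diff)
    hence "[g ^ (m div 2 * d) = g ^ 0] (mod p)" by (metis cong_int_iff power_0 of_nat_1)
    hence "p - 1 dvd m div 2 * d" unfolding g_pow_cong by (simp add: Cong.cong_0_iff)
    moreover have "m div 2 * d > 0" using e p_gt_2 by (intro Nat.gr0I) simp
    moreover have "m div 2 * d < p - 1" using calculation(2) unfolding e[symmetric] by linarith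
    ultimately show False using nat_dvd_not_less by blast
  qed
  ultimately have "int p dvd ?x + 1" by blast
  hence "int p dvd (?x + 1) - int p" by (rule dvd_diff) simp
  also have "(?x + 1) - int p = ?x - int (p - 1)" using p_gt_2 by simp
  finally have "int p dvd ?x - int (p - 1)" .
  thus "[g ^ (m div 2 * d) = p - 1] (mod p)" by (simp add: cong_iff_dvd_diff flip: cong_int_iff)
qed

text \<open>A concrete form of G: every subgroup of order \<open>d\<close> lies in the kernel of the
  d-th power map.\<close>

definition H :: "int set" where "H = {x \<in> {1..int p - 1}. [x ^ d = 1] (mod int p)}"

lemma H_alt: "H = (\<lambda>j. int (g ^ (m * j) mod p)) ` {..<d}"
proof (intro equalityI subsetI)
  fix x assume x: "x \<in> H"
  define a where "a = nat x"
  have a: "x = int a" "0 < a" "a < p" using x by (auto simp: a_def H_def)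
  have "\<not> p dvd a" using a by (auto dest: dvd_imp_le)
  then obtain i where i: "i < p - 1" "a mod p = g ^ i mod p" using g_log by blast
  have ag: "a = g ^ i mod p" using i a by simp
  have "[a ^ d = 1] (mod p)" using x by (simp add: H_def a(1) flip: cong_int_iff)
  moreover have "[a ^ d = (g ^ i) ^ d] (mod p)"
    unfolding ag by (intro cong_pow) simp
  ultimately have "[g ^ (i * d) = g ^ 0] (mod p)"
    by (metis cong_sym cong_trans power_0 power_mult)
  hence "d * m dvd i * d" unfolding g_pow_cong p_minus_1 by (simp add: Cong.cong_0_iff)
  hence "m dvd i" using d_pos by (simp add: mult.commute)
  then obtain j where j: "i = m * j" by blast
  have "j < d" using i(1) j p_minus_1 m_pos by (simp add: mult.commute)
  thus "x \<in> (\<lambda>j. int (g ^ (m * j) mod p)) ` {..<d}" using a(1) ag j by auto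
next
  fix x assume "x \<in> (\<lambda>j. int (g ^ (m * j) mod p)) ` {..<d}"
  then obtain j where j: "j < d" "x = int (g ^ (m * j) mod p)" by blast
  have "g ^ (m * j) mod p \<in> {0<..<p}" using g_pow_mod by simp
  moreover have "[(g ^ (m * j) mod p) ^ d = (g ^ (m * j)) ^ d] (mod p)" by (intro cong_pow) simp
  moreover have "[g ^ (m * j * d) = g ^ 0] (mod p)"
    unfolding g_pow_cong p_minus_1 by (simp add: Cong.cong_0_iff)
  ultimately have "[(g ^ (m * j) mod p) ^ d = 1] (mod p)" "g ^ (m * j) mod p \<in> {0<..<p}"
    using cong_trans by (auto simp: power_mult)
  thus "x \<in> H" unfolding j(2) H_def using p_gt_2 by (auto simp flip: cong_int_iff)
qed

lemma card_H: "card H = d"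
proof -
  have "inj_on (\<lambda>j. int (g ^ (m * j) mod p)) {..<d}"
  proof (rule inj_onI)
    fix i j assume ij: "i \<in> {..<d}" "j \<in> {..<d}" "int (g ^ (m * i) mod p) = int (g ^ (m * j) mod p)"
    have "m * i < p - 1" "m * j < p - 1" using ij p_minus_1 m_pos by (simp_all add: mult.commute)
    moreover have "g ^ (m * i) mod p = g ^ (m * j) mod p" using ij by simp
    ultimately have "m * i = m * j" using g_pow_mod_eqD by blast
    thus "i = j" using m_pos by simp
  qed
  thus ?thesis by (simp add: H_alt card_image)
qed

lemma order_Fp_star: "Coset.order (Fp_star p) = d * m" "finite (carrier (Fp_star p))"
  using p_minus_1 p_gt_2 by (auto simp: Coset.order_def Fp_star_simps nat_diff_distrib)

lemma subgroup_H: "subgroup H (Fp_star p)"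
proof (rule Fp.subgroupI)
  show "H \<noteq> {}" using card_H d_pos by auto
  have H_iff: "x \<in> H \<longleftrightarrow> x \<in> carrier (Fp_star p) \<and> x [^]\<^bsub>Fp_star p\<^esub> d = \<one>\<^bsub>Fp_star p\<^esub>" for x
    using p_gt_2 by (auto simp: H_def Fp_star_simps Fp_star_pow unique_euclidean_semiring_class.cong_def)
  show "H \<subseteq> carrier (Fp_star p)" using H_iff by blast
  show "inv\<^bsub>Fp_star p\<^esub> x \<in> H" if "x \<in> H" for x
    using that unfolding H_iff by (simp add: Fp.nat_pow_inv)
  show "x \<otimes>\<^bsub>Fp_star p\<^esub> y \<in> H" if "x \<in> H" "y \<in> H" for x y
    using that unfolding H_iff by (simp add: Fp.pow_mult_distrib Fp.m_comm)
qed

text \<open>By Lagrange a subgroup of index \<open>m\<close> has order \<open>d\<close>, so its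
  elements satisfy x^d = 1 and lie in \<open>H\<close>; equal cardinalities give equality. This
  discharges the definite description.\<close>

lemma subgroup_of_index_eq: "subgroup_of_index p m = H"
  unfolding subgroup_of_index_def
proof (rule the_equality, intro conjI)
  show "subgroup H (Fp_star p)" by (rule subgroup_H)
  have "card (rcosets\<^bsub>Fp_star p\<^esub> H) * card H = Coset.order (Fp_star p)"
    by (rule Fp.lagrange[OF subgroup_H])
  thus "card (rcosets\<^bsub>Fp_star p\<^esub> H) = m" using d_pos by (simp add: card_H order_Fp_star)
next
  fix K assume "subgroup K (Fp_star p) \<and> card (rcosets\<^bsub>Fp_star p\<^esub> K) = m"
  hence K: "subgroup K (Fp_star p)" "card (rcosets\<^bsub>Fp_star p\<^esub> K) = m" by auto
  have "card (rcosets\<^bsub>Fp_star p\<^esub> K) * card K = Coset.order (Fp_star p)"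
    by (rule Fp.lagrange[OF K(1)])
  hence cK: "card K = d" using m_pos by (simp add: K(2) order_Fp_star)
  have "K \<subseteq> H"
  proof
    fix x assume x: "x \<in> K"
    have "group (Fp_star p\<lparr>carrier := K\<rparr>)" using K(1) Fp.subgroup_imp_group by blast
    hence "x [^]\<^bsub>Fp_star p\<lparr>carrier := K\<rparr>\<^esub> Coset.order (Fp_star p\<lparr>carrier := K\<rparr>) = \<one>\<^bsub>Fp_star p\<lparr>carrier := K\<rparr>\<^esub>"
      using x by (intro group.pow_order_eq_1) auto
    hence "x [^]\<^bsub>Fp_star p\<^esub> d = \<one>\<^bsub>Fp_star p\<^esub>"
      by (simp add: Coset.order_def cK flip: Fp.nat_pow_consistent)
    moreover have "x \<in> carrier (Fp_star p)" using K(1) x subgroup.subset by blast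
    ultimately show "x \<in> H"
      using p_gt_2 by (auto simp: H_def Fp_star_simps Fp_star_pow unique_euclidean_semiring_class.cong_def)
  qed
  moreover have "finite H" by (simp add: H_alt)
  ultimately show "K = H" using card_subset_eq cK card_H by metis
qed

section \<open>Parametrisation of the odd characters by their value at a primitive root\<close>

lemma mem_odd_chars:
  "\<chi> \<in> odd_chars_trivial p m \<longleftrightarrow> \<chi> \<in> hom (Fp_star p) Cstar \<and> (\<forall>a. a \<notin> {1..int p - 1} \<longrightarrow> \<chi> a = 0)
     \<and> (\<forall>a\<in>H. \<chi> a = 1) \<and> \<chi> (int p - 1) = -1"
proof -
  have "(-1) mod int p = int p - 1" using p_gt_2 by (simp add: zmod_minus1)
  thus ?thesis
    by (auto simp: odd_chars_trivial_def chars_trivial_def mult_chars_def subgroup_of_index_eq Fp_star_simps)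
qed

lemma hom_mult:
  assumes "\<chi> \<in> hom (Fp_star p) Cstar" "a \<in> {1..int p - 1}" "b \<in> {1..int p - 1}"
  shows "\<chi> (a * b mod int p) = \<chi> a * \<chi> b" "\<chi> a \<noteq> 0"
  using hom_mult[OF assms(1), of a b] hom_in_carrier[OF assms(1), of a] assms(2,3)
  by (auto simp: Fp_star_simps Cstar_def)

lemma g_pow_mem: "int (g ^ k mod p) \<in> {1..int p - 1}"
  using g_pow_mod[of k] by auto

lemma char_g_pow:
  assumes "\<chi> \<in> hom (Fp_star p) Cstar"
  shows "\<chi> (int (g ^ k mod p)) = \<chi> (int (g mod p)) ^ k"
proof (induction k)
  case 0
  have one: "(1::int) \<in> {1..int p - 1}" using p_gt_2 by simp
  have "\<chi> (1 * 1 mod int p) = \<chi> 1 * \<chi> 1" "\<chi> 1 \<noteq> 0" using hom_mult[OF assms one one] by auto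
  thus ?case using p_gt_2 by simp
next
  case (Suc k)
  have "\<chi> (int (g mod p) * int (g ^ k mod p) mod int p) = \<chi> (int (g mod p)) * \<chi> (int (g ^ k mod p))"
    using g_pow_mem[of 1] g_pow_mem[of k] by (intro hom_mult[OF assms]) auto
  also have "int (g mod p) * int (g ^ k mod p) mod int p = int (g ^ Suc k mod p)"
    by (simp add: zmod_int mod_mult_eq)
  finally show ?case using Suc by simp
qed

text \<open>This is the index of \<plusminus>G and also the number of odd characters.\<close>

definition h :: nat where "h = m div 2"

lemma p_minus_1': "p - 1 = h * (2 * d)" and h_pos: "h > 0"
proof -
  have "m = h * 2" using m_even by (simp add: h_def)
  thus "p - 1 = h * (2 * d)" "h > 0" using p_minus_1 m_pos by auto
qed

definition dlog :: "nat \<Rightarrow> nat" where "dlog = the_inv_into {..<p - 1} (\<lambda>i. g ^ i mod p)"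

text \<open>When z^h = -1, this is the character that sends the primitive root \<open>g\<close> to
  \<open>z\<close>.\<close>

definition char_of :: "complex \<Rightarrow> int \<Rightarrow> complex" where
  "char_of z a = (if a \<in> {1..int p - 1} then z ^ dlog (nat a) else 0)"

lemma dlog_g_pow: "dlog (g ^ k mod p) = k mod (p - 1)"
proof -
  have k: "k mod (p - 1) < p - 1" using p_gt_2 by simp
  have "[g ^ k = g ^ (k mod (p - 1))] (mod p)" by (simp add: g_pow_cong)
  hence "g ^ k mod p = g ^ (k mod (p - 1)) mod p" by (simp add: unique_euclidean_semiring_class.cong_def)
  thus ?thesis
    unfolding dlog_def using the_inv_into_f_f[OF bij_betw_imp_inj_on[OF g_bij], of "k mod (p - 1)"] k by simp
qed

lemma pow_p_minus_1:
  assumes "z ^ h = (-1 :: complex)" shows "z ^ (p - 1) = 1" "norm z = 1"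
proof -
  show 1: "z ^ (p - 1) = 1" unfolding p_minus_1' power_mult assms by simp
  thus "norm z = 1" using p_gt_2 power_eq_1_iff[of z "p - 1"] by auto
qed

lemma char_of_g_pow:
  assumes "z ^ h = -1"
  shows "char_of z (int (g ^ k mod p)) = z ^ k"
proof -
  have "z ^ k = z ^ ((p - 1) * (k div (p - 1)) + k mod (p - 1))" by simp
  also have "\<dots> = z ^ (k mod (p - 1))"
    by (simp only: power_add power_mult pow_p_minus_1(1)[OF assms]) simp
  finally show ?thesis using g_pow_mem[of k] by (simp add: char_of_def dlog_g_pow)
qed

lemma mem_Fp_star_g_pow:
  assumes "a \<in> {1..int p - 1}"
  obtains i where "i < p - 1" "a = int (g ^ i mod p)"
proof -
  have "\<not> p dvd nat a" using assms by (auto dest: dvd_imp_le)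
  then obtain i where "i < p - 1" "nat a mod p = g ^ i mod p" using g_log by blast
  moreover have "int (nat a mod p) = a" using assms by (simp add: zmod_int)
  ultimately show ?thesis using that[of i] by simp
qed

lemma g_pow_half': "int (g ^ (h * d) mod p) = int p - 1"
proof -
  have "g ^ (h * d) mod p = (p - 1) mod p"
    using g_pow_half by (simp add: h_def unique_euclidean_semiring_class.cong_def)
  thus ?thesis using p_gt_2 by simp
qed

lemma neg_one_power_odd: "(z::complex) = 1 \<or> z = -1 \<Longrightarrow> z ^ d = z"
  using odd_d by auto

text \<open>A character is determined by its value \<open>z\<close> at \<open>g\<close>. Triviality
  on \<open>H\<close> gives z^m = 1, so z^h is 1 or -1. Since -1 = g^(h d) with \<open>d\<close>
  odd, the value at -1 is z^h, and oddness selects z^h = -1.\<close>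

lemma odd_chars_eq: "odd_chars_trivial p m = char_of ` {z. z ^ h = -1}"
proof (intro equalityI subsetI)
  fix \<chi> assume "\<chi> \<in> odd_chars_trivial p m"
  hence \<chi>: "\<chi> \<in> hom (Fp_star p) Cstar" "\<And>a. a \<notin> {1..int p - 1} \<Longrightarrow> \<chi> a = 0"
    "\<And>a. a \<in> H \<Longrightarrow> \<chi> a = 1" "\<chi> (int p - 1) = -1" by (auto simp: mem_odd_chars)
  define z where "z = \<chi> (int (g mod p))"
  have "z ^ m = 1"
  \<comment> \<open>\<open>H\<close> is listed as g^(m j) with j < d, so the index j = 1 is
    available only for d > 1. For d = 1 one has m = p - 1, and z^m = 1 is Fermat's theorem.\<close>
  proof (cases "d = 1")
    case True
    have "z ^ (p - 1) = z ^ 0"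
    proof -
      have "[g ^ (p - 1) = g ^ 0] (mod p)" unfolding g_pow_cong by (simp add: Cong.cong_0_iff)
      hence "g ^ (p - 1) mod p = g ^ 0 mod p" by (simp add: unique_euclidean_semiring_class.cong_def)
      thus ?thesis unfolding z_def char_g_pow[OF \<chi>(1), symmetric] by simp
    qed
    thus ?thesis using True p_minus_1 by simp
  next
    case False
    hence "1 \<in> {..<d}" using d_pos by auto
    hence "int (g ^ (m * 1) mod p) \<in> H" unfolding H_alt by (rule image_eqI[OF refl])
    thus ?thesis using \<chi>(3) char_g_pow[OF \<chi>(1), of m] by (simp add: z_def)
  qed
  moreover have "m = h * 2" using m_even by (simp add: h_def)
  ultimately have "(z ^ h) ^ 2 = 1" by (metis power_mult)
  hence "(z ^ h) ^ d = z ^ h" by (intro neg_one_power_odd) (simp add: power2_eq_1_iff)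
  moreover have "z ^ (h * d) = -1"
    using \<chi>(4) char_g_pow[OF \<chi>(1), of "h * d"] unfolding g_pow_half' z_def by simp
  ultimately have z: "z ^ h = -1" by (simp add: power_mult)
  have "\<chi> a = char_of z a" for a
  proof (cases "a \<in> {1..int p - 1}")
    case True
    then obtain i where i: "a = int (g ^ i mod p)" using mem_Fp_star_g_pow by blast
    show ?thesis unfolding i char_g_pow[OF \<chi>(1)] char_of_g_pow[OF z] by (simp add: z_def)
  next
    case False
    hence "char_of z a = 0" by (simp only: char_of_def if_False)
    thus ?thesis using \<chi>(2)[OF False] by (simp only:)
  qed
  thus "\<chi> \<in> char_of ` {z. z ^ h = -1}" using z by blast
next
  fix \<chi> assume "\<chi> \<in> char_of ` {z. z ^ h = -1}"
  then obtain z where z: "z ^ h = -1" "\<chi> = char_of z" by blast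
  have z0: "z \<noteq> 0" using z(1) h_pos by (auto simp: power_0_left)
  have "char_of z \<in> hom (Fp_star p) Cstar"
  proof (rule homI)
    fix a assume "a \<in> carrier (Fp_star p)"
    thus "char_of z a \<in> carrier Cstar" using z0 by (simp add: Cstar_def char_of_def Fp_star_simps)
    fix b assume "b \<in> carrier (Fp_star p)"
    obtain i where i: "a = int (g ^ i mod p)"
      using mem_Fp_star_g_pow \<open>a \<in> carrier (Fp_star p)\<close> unfolding Fp_star_simps by blast
    obtain j where j: "b = int (g ^ j mod p)"
      using mem_Fp_star_g_pow \<open>b \<in> carrier (Fp_star p)\<close> unfolding Fp_star_simps by blast
    have "a * b mod int p = int (g ^ (i + j) mod p)"
      by (simp add: i j zmod_int mod_mult_eq power_add)
    thus "char_of z (a \<otimes>\<^bsub>Fp_star p\<^esub> b) = char_of z a \<otimes>\<^bsub>Cstar\<^esub> char_of z b"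
      by (simp only: Fp_star_simps char_of_g_pow[OF z(1)] power_add[of z])
         (simp only: i j char_of_g_pow[OF z(1)] Cstar_def monoid.simps)
  qed
  moreover have "char_of z a = 1" if a: "a \<in> H" for a
  proof -
    obtain j where j: "a = int (g ^ (m * j) mod p)" using a unfolding H_alt by blast
    have "m = h * 2" using m_even by (simp add: h_def)
    hence zm: "z ^ m = (z ^ h) ^ 2" by (metis power_mult)
    have "char_of z a = z ^ (m * j)" unfolding j by (rule char_of_g_pow[OF z(1)])
    also have "\<dots> = (z ^ m) ^ j" by (rule power_mult)
    also have "\<dots> = 1" unfolding zm z(1) by simp
    finally show ?thesis .
  qed
  moreover have "char_of z (int p - 1) = -1"
  proof -
    have "char_of z (int p - 1) = z ^ (h * d)"
      using char_of_g_pow[OF z(1), of "h * d"] by (simp only: g_pow_half')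
    also have "\<dots> = (z ^ h) ^ d" by (rule power_mult)
    also have "\<dots> = -1" unfolding z(1) by (rule neg_one_power_odd) simp
    finally show ?thesis .
  qed
  moreover have "char_of z a = 0" if "a \<notin> {1..int p - 1}" for a
    using that by (simp only: char_of_def if_False)
  ultimately show "\<chi> \<in> odd_chars_trivial p m" unfolding mem_odd_chars z(2) by blast
qed

lemma inj_on_char_of: "inj_on char_of {z. z ^ h = -1}"
proof (rule inj_onI)
  fix z w assume *: "z \<in> {z. z ^ h = -1}" "w \<in> {z. z ^ h = -1}" "char_of z = char_of w"
  hence "char_of z (int (g ^ 1 mod p)) = char_of w (int (g ^ 1 mod p))" by (simp only:)
  thus "z = w" using * char_of_g_pow[of z 1] char_of_g_pow[of w 1] by simp
qed

lemma card_odd_chars: "2 * card (odd_chars_trivial p m) = m"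
proof -
  have "card (odd_chars_trivial p m) = h"
    unfolding odd_chars_eq using inj_on_char_of roots_minus_one[OF h_pos] by (simp add: card_image)
  thus ?thesis using m_even by (simp add: h_def)
qed

section \<open>Values and orthogonality of the odd characters\<close>

lemma odd_char_dvd: "\<chi> \<in> odd_chars_trivial p m \<Longrightarrow> p dvd a \<Longrightarrow> \<chi> (int a mod int p) = 0"
  by (auto simp: odd_chars_eq char_of_def)

lemma norm_odd_char:
  assumes "\<chi> \<in> odd_chars_trivial p m"
  shows "norm (\<chi> (int a mod int p)) = (if p dvd a then 0 else 1)"
proof (cases "p dvd a")
  case False
  obtain z where z: "z ^ h = -1" "\<chi> = char_of z" using assms by (auto simp: odd_chars_eq)
  obtain i where "a mod p = g ^ i mod p" using g_log[OF False] by blast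
  hence "\<chi> (int a mod int p) = z ^ i"
    unfolding z(2) using char_of_g_pow[OF z(1), of i] by (simp flip: zmod_int)
  thus ?thesis using False pow_p_minus_1(2)[OF z(1)] by (simp add: norm_power)
qed (use odd_char_dvd[OF assms] in simp)

text \<open>In terms of \<open>z\<close> each summand is z^k, summed over a coset of the h-th roots
  of unity. The sum vanishes unless \<open>h\<close> divides \<open>k\<close>, and then a and b
  would have the same power with exponent 2 d = (p - 1) / h.\<close>

lemma odd_chars_orthogonal:
  assumes "\<not> p dvd a" "\<not> p dvd b" "\<not> [a ^ (2 * d) = b ^ (2 * d)] (mod p)"
  shows "(\<Sum>\<chi>\<in>odd_chars_trivial p m. \<chi> (int a mod int p) * cnj (\<chi> (int b mod int p))) = 0"
proof -
  obtain i where i: "i < p - 1" "a mod p = g ^ i mod p" using g_log[OF assms(1)] by blast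
  obtain j where j: "j < p - 1" "b mod p = g ^ j mod p" using g_log[OF assms(2)] by blast
  \<comment> \<open>This represents i - j modulo p - 1 without truncated subtraction.\<close>
  define k where "k = i + (p - 1 - j)"
  have kj: "k + j = i + (p - 1)" using j by (simp add: k_def)
  \<comment> \<open>Rotation by a primitive h-th root \<open>w\<close> preserves z^h = -1, and w^k =
    1 would force \<open>h\<close> to divide \<open>k\<close>.\<close>
  have "primitive_unity_roots h \<noteq> {}"
    using card_primitive_unity_roots[OF h_pos] h_pos by (metis card.empty less_irrefl totient_gt_0_iff)
  then obtain w where w: "w \<in> primitive_unity_roots h" by blast
  have nd: "\<not> h dvd k"
  proof
    assume "h dvd k"
    hence "p - 1 dvd k * (2 * d)" unfolding p_minus_1' by simp
    hence "[k * (2 * d) + j * (2 * d) = 0 + j * (2 * d)] (mod (p - 1))"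
      by (intro cong_add cong_refl) (simp add: Cong.cong_0_iff)
    moreover have "k * (2 * d) + j * (2 * d) = i * (2 * d) + (p - 1) * (2 * d)"
      using kj by (metis distrib_right)
    moreover have "[i * (2 * d) + (p - 1) * (2 * d) = i * (2 * d) + 0] (mod (p - 1))"
      by (intro cong_add cong_refl) (simp add: Cong.cong_0_iff)
    ultimately have "[i * (2 * d) = j * (2 * d)] (mod (p - 1))"
      by (metis add_0 add_0_right cong_sym cong_trans)
    hence "[(g ^ i) ^ (2 * d) = (g ^ j) ^ (2 * d)] (mod p)"
      unfolding power_mult[symmetric] g_pow_cong .
    moreover have "[a = g ^ i] (mod p)" "[b = g ^ j] (mod p)"
      using i j by (simp_all add: unique_euclidean_semiring_class.cong_def)
    ultimately show False using assms(3) by (meson cong_pow cong_sym cong_trans)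
  qed
  have "(\<Sum>\<chi>\<in>odd_chars_trivial p m. \<chi> (int a mod int p) * cnj (\<chi> (int b mod int p))) =
        (\<Sum>z | z ^ h = -1. char_of z (int a mod int p) * cnj (char_of z (int b mod int p)))"
    unfolding odd_chars_eq by (simp add: sum.reindex[OF inj_on_char_of])
  also have "\<dots> = (\<Sum>z | z ^ h = -1. z ^ k)"
  proof (intro sum.cong refl)
    fix z :: complex assume "z \<in> {z. z ^ h = -1}"
    hence z: "z ^ h = -1" by simp
    have a: "char_of z (int a mod int p) = z ^ i" and b: "char_of z (int b mod int p) = z ^ j"
      using char_of_g_pow[OF z, of i] char_of_g_pow[OF z, of j] i j by (simp_all flip: zmod_int)
    have "z ^ j * z ^ (p - 1 - j) = 1"
      using j pow_p_minus_1(1)[OF z] by (simp flip: power_add)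
    moreover have "z ^ j * cnj (z ^ j) = 1"
      using pow_p_minus_1(2)[OF z] by (simp add: complex_norm_square[symmetric] norm_power del: complex_cnj_power)
    moreover have "z ^ j \<noteq> 0" using pow_p_minus_1(2)[OF z] by auto
    ultimately have "cnj (z ^ j) = z ^ (p - 1 - j)" by (metis mult_left_cancel)
    thus "char_of z (int a mod int p) * cnj (char_of z (int b mod int p)) = z ^ k"
      unfolding a b by (simp add: k_def power_add)
  qed
  also have "\<dots> = 0"
  proof (rule sum_powers_eq_0[of w])
    show "w ^ k \<noteq> 1" using primitive_unity_root_dvd[OF w h_pos] nd by blast
    show "w \<noteq> 0" using w h_pos by (auto simp: primitive_unity_roots_def power_0_left)
    show "w * z \<in> {z. z ^ h = -1} \<longleftrightarrow> z \<in> {z. z ^ h = -1}" for z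
      using w by (simp add: primitive_unity_roots_def power_mult_distrib)
  qed
  finally show ?thesis .
qed

text \<open>The reflection of a to p - a changes the sign of every value.\<close>

lemma sum_odd_char_eq_0:
  assumes "\<chi> \<in> odd_chars_trivial p m"
  shows "(\<Sum>a\<in>{1..int p - 1}. \<chi> a) = 0"
proof -
  have \<chi>: "\<chi> \<in> hom (Fp_star p) Cstar" "\<chi> (int p - 1) = -1" using assms by (auto simp: mem_odd_chars)
  have "\<chi> (int p - a) = - \<chi> a" if a: "a \<in> {1..int p - 1}" for a
  proof -
    have "(int p - 1) * a mod int p = (int p - a + (a - 1) * int p) mod int p"
      by (simp add: algebra_simps)
    also have "\<dots> = (int p - a) mod int p" by (rule mod_mult_self1)
    also have "\<dots> = int p - a" using a by (intro mod_pos_pos_trivial) auto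
    finally show ?thesis using hom_mult[OF \<chi>(1), of "int p - 1" a] a \<chi>(2) by simp
  qed
  moreover have "(\<Sum>a\<in>{1..int p - 1}. \<chi> (int p - a)) = (\<Sum>a\<in>{1..int p - 1}. \<chi> a)"
    by (rule sum.reindex_bij_witness[of _ "\<lambda>a. int p - a" "\<lambda>a. int p - a"]) auto
  ultimately have "- (\<Sum>a\<in>{1..int p - 1}. \<chi> a) = (\<Sum>a\<in>{1..int p - 1}. \<chi> a)"
    by (simp add: sum_negf)
  thus ?thesis by simp
qed

end

section \<open>Truncation of \<open>L(1, \<chi>)\<close>\<close>

text \<open>Summation by parts against the decreasing weights 1 / (k + 1). The same tail estimate
  makes the partial sums Cauchy, so that \<open>suminf\<close> is the limit of the conditionally
  convergent series.\<close>

lemma abel_summation_tail: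
  fixes f :: "nat \<Rightarrow> complex"
  assumes bound: "\<And>n. norm (\<Sum>k<n. f k) \<le> B"
  shows "norm ((\<Sum>k. f k / of_nat (Suc k)) - (\<Sum>k<N. f k / of_nat (Suc k))) \<le> 2 * B / real (N + 1)"
proof -
  define A where "A n = (\<Sum>k<n. f k)" for n
  define S where "S n = (\<Sum>k<n. f k / of_nat (Suc k))" for n
  have B: "B \<ge> 0" using bound[of 0] by simp
  have A: "norm (A n) \<le> B" for n using bound by (simp add: A_def)
  have parts: "S (N + j) - S N = A (N + j) / of_nat (N + j + 1) - A N / of_nat (N + 1)
      + (\<Sum>k<j. A (N + k + 1) * of_real (1 / real (N + k + 1) - 1 / real (N + k + 2)))" for N j
  proof (induction j)
    case (Suc j)
    have f: "f (N + j) = A (N + j + 1) - A (N + j)" by (simp add: A_def)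
    have "of_nat (N + j + 1) \<noteq> (0::complex)" "of_nat (N + j + 2) \<noteq> (0::complex)"
      by (simp_all only: of_nat_eq_0_iff)
    hence *: "f (N + j) / of_nat (N + j + 1) = A (N + j + 1) / of_nat (N + j + 2) - A (N + j) / of_nat (N + j + 1)
      + A (N + j + 1) * of_real (1 / real (N + j + 1) - 1 / real (N + j + 2))"
      unfolding f by (simp add: diff_divide_distrib right_diff_distrib del: of_nat_add of_nat_Suc)
    have "S (N + Suc j) - S N = (S (N + j) - S N) + f (N + j) / of_nat (N + j + 1)"
      by (simp add: S_def)
    thus ?case unfolding Suc.IH * by (simp del: of_nat_add of_nat_Suc)
  qed simp
  have tele: "(\<Sum>k<j. 1 / real (N + k + 1) - 1 / real (N + k + 2)) = 1 / real (N + 1) - 1 / real (N + j + 1)" for N j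
    by (induction j) (auto simp: algebra_simps)
  have tail: "norm (S (N + j) - S N) \<le> 2 * B / real (N + 1)" for N j
  proof -
    have "norm (\<Sum>k<j. A (N + k + 1) * of_real (1 / real (N + k + 1) - 1 / real (N + k + 2)))
       \<le> (\<Sum>k<j. B * (1 / real (N + k + 1) - 1 / real (N + k + 2)))"
    proof (rule sum_norm_le)
      fix k
      have "1 / real (N + k + 2) \<le> 1 / real (N + k + 1)" by (intro divide_left_mono) auto
      thus "norm (A (N + k + 1) * of_real (1 / real (N + k + 1) - 1 / real (N + k + 2)))
         \<le> B * (1 / real (N + k + 1) - 1 / real (N + k + 2))"
        unfolding norm_mult norm_of_real using A[of "N + k + 1"] B by (intro mult_mono) auto
    qed
    also have "\<dots> = B * (1 / real (N + 1) - 1 / real (N + j + 1))"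
      unfolding sum_distrib_left[symmetric] tele ..
    finally have 1: "norm (\<Sum>k<j. A (N + k + 1) * of_real (1 / real (N + k + 1) - 1 / real (N + k + 2)))
       \<le> B * (1 / real (N + 1) - 1 / real (N + j + 1))" .
    have 2: "norm (A (N + j) / of_nat (N + j + 1)) \<le> B * (1 / real (N + j + 1))"
      using A[of "N + j"] unfolding norm_divide norm_of_nat by (simp add: divide_right_mono)
    have 3: "norm (A N / of_nat (N + 1)) \<le> B * (1 / real (N + 1))"
      using A[of N] unfolding norm_divide norm_of_nat by (simp add: divide_right_mono)
    \<comment> \<open>The contributions at N + j + 1 cancel, which makes the bound uniform in
      \<open>j\<close>.\<close>
    have "norm (S (N + j) - S N) \<le> B * (1 / real (N + j + 1)) + B * (1 / real (N + 1))
       + B * (1 / real (N + 1) - 1 / real (N + j + 1))"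
      unfolding parts by (intro norm_triangle_le add_mono norm_triangle_le_diff 1 2 3)
    thus ?thesis by (simp add: algebra_simps)
  qed
  have "Cauchy S"
  proof (rule CauchyI')
    fix e :: real assume e: "e > 0"
    obtain M where M: "2 * B / e < real M" using reals_Archimedean2 by blast
    have "norm (S m - S n) < e" if "M \<le> m" "m < n" for m n
    proof -
      have "norm (S n - S m) \<le> 2 * B / real (m + 1)" using tail[of m "n - m"] that by simp
      also have "\<dots> < e"
      proof -
        have "2 * B < e * real M" using M e by (simp add: field_simps)
        also have "\<dots> \<le> e * real (m + 1)" using that e by (intro mult_left_mono) auto
        finally show ?thesis by (simp add: field_simps)
      qed
      finally show ?thesis by (simp add: norm_minus_commute)
    qed
    thus "\<exists>M. \<forall>m\<ge>M. \<forall>n>m. dist (S m) (S n) < e" by (auto simp: dist_norm)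
  qed
  hence "convergent S" by (rule Cauchy_convergent)
  hence "summable (\<lambda>k. f k / of_nat (Suc k))" unfolding summable_iff_convergent S_def[abs_def] .
  hence "S \<longlonglongrightarrow> (\<Sum>k. f k / of_nat (Suc k))" unfolding S_def by (rule summable_LIMSEQ)
  hence "(\<lambda>j. S (N + j)) \<longlonglongrightarrow> (\<Sum>k. f k / of_nat (Suc k))"
    using LIMSEQ_ignore_initial_segment[of S _ N] by (simp add: add.commute)
  hence "(\<lambda>j. norm (S (N + j) - S N)) \<longlonglongrightarrow> norm ((\<Sum>k. f k / of_nat (Suc k)) - S N)"
    by (intro tendsto_intros)
  hence "norm ((\<Sum>k. f k / of_nat (Suc k)) - S N) \<le> 2 * B / real (N + 1)"
    by (rule LIMSEQ_le_const2) (use tail in auto)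
  thus ?thesis by (simp add: S_def)
qed

lemma abs_power4_diff_le:
  fixes x y M :: real
  assumes "0 \<le> x" "0 \<le> y" "x \<le> M" "y \<le> M"
  shows "\<bar>x ^ 4 - y ^ 4\<bar> \<le> 4 * M ^ 3 * \<bar>x - y\<bar>"
proof -
  have "x ^ 4 - y ^ 4 = (x ^ 3 + x ^ 2 * y + x * y ^ 2 + y ^ 3) * (x - y)"
    by (simp add: eval_nat_numeral algebra_simps)
  moreover have "x ^ 3 + x ^ 2 * y + x * y ^ 2 + y ^ 3 \<le> M ^ 3 + M ^ 2 * M + M * M ^ 2 + M ^ 3"
    using assms by (intro add_mono mult_mono power_mono) auto
  moreover have "M ^ 3 + M ^ 2 * M + M * M ^ 2 + M ^ 3 = 4 * M ^ 3"
    by (simp add: eval_nat_numeral algebra_simps)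
  moreover have "0 \<le> x ^ 3 + x ^ 2 * y + x * y ^ 2 + y ^ 3" using assms by simp
  ultimately show ?thesis by (simp add: abs_mult mult_right_mono)
qed

context odd_order_subgroup
begin

text \<open>Full periods cancel, and what remains has fewer than \<open>p\<close> terms of norm at
  most 1.\<close>

lemma odd_char_partial_sum:
  assumes \<chi>: "\<chi> \<in> odd_chars_trivial p m"
  shows "norm (\<Sum>k<n. \<chi> (int (Suc k) mod int p)) \<le> real p"
proof -
  define A where "A n = (\<Sum>k<n. \<chi> (int (Suc k) mod int p))" for n
  have "A p = (\<Sum>k<p - 1. \<chi> (int (Suc k) mod int p)) + \<chi> (int p mod int p)"
  proof -
    have "Suc (p - 1) = p" using p_gt_2 by simp
    thus ?thesis
      unfolding A_def using sum.lessThan_Suc[of "\<lambda>k. \<chi> (int (Suc k) mod int p)" "p - 1"] by (simp only:)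
  qed
  also have "\<chi> (int p mod int p) = 0" using odd_char_dvd[OF \<chi>, of p] by simp
  also have "(\<Sum>k<p - 1. \<chi> (int (Suc k) mod int p)) = (\<Sum>a\<in>{1..int p - 1}. \<chi> a)"
    by (rule sum.reindex_bij_witness[of _ "\<lambda>a. nat a - 1" "\<lambda>k. int (Suc k)"]) auto
  finally have Ap: "A p = 0" using sum_odd_char_eq_0[OF \<chi>] by simp
  have shift: "A (p + n) = A n" for n
  proof (induction n)
    case (Suc n)
    have "int (Suc (p + n)) mod int p = int (Suc n) mod int p"
      by (metis add_Suc_right mod_add_self1 of_nat_mod)
    thus ?case using Suc by (simp add: A_def)
  next
    case 0
    show ?case using Ap by (simp add: A_def)
  qed
  have "norm (A n) \<le> real p"
  proof (induction n rule: less_induct)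
    case (less n)
    show ?case
    proof (cases "n < p")
      case True
      have "norm (A n) \<le> (\<Sum>k<n. norm (\<chi> (int (Suc k) mod int p)))" unfolding A_def by (rule norm_sum)
      also have "\<dots> \<le> (\<Sum>k<n. 1)" by (intro sum_mono) (simp add: norm_odd_char[OF \<chi>] del: of_nat_Suc)
      finally show ?thesis using True by simp
    next
      case False
      thus ?thesis using less[of "n - p"] shift[of "n - p"] p_gt_2 by simp
    qed
  qed
  thus ?thesis by (simp add: A_def)
qed

text \<open>With partial sums bounded by \<open>p\<close>, the length p^2 leaves a tail of size
  O(1/p).\<close>

definition L_trunc :: "(int \<Rightarrow> complex) \<Rightarrow> complex" where
  "L_trunc \<chi> = (\<Sum>n\<in>{1..p ^ 2}. \<chi> (int n mod int p) / of_nat n)"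

lemma L_trunc_alt: "L_trunc \<chi> = (\<Sum>k<p ^ 2. \<chi> (int (Suc k) mod int p) / of_nat (Suc k))"
  unfolding L_trunc_def
  by (rule sum.reindex_bij_witness[of _ Suc "\<lambda>n. n - 1"]) auto

lemma L_one_trunc:
  assumes \<chi>: "\<chi> \<in> odd_chars_trivial p m"
  shows "\<bar>cmod (L_one p \<chi>) ^ 4 - cmod (L_trunc \<chi>) ^ 4\<bar> \<le> 8 / real p * (3 + 2 * ln (real p)) ^ 3"
proof -
  have "norm (L_one p \<chi> - L_trunc \<chi>) \<le> 2 * real p / real (p ^ 2 + 1)"
    unfolding L_one_def L_trunc_alt using abel_summation_tail[OF odd_char_partial_sum[OF \<chi>]] .
  also have "\<dots> \<le> 2 * real p / real (p ^ 2)" using p_gt_2 by (intro frac_le) auto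
  also have "\<dots> = 2 / real p" using p_gt_2 by (simp add: power2_eq_square)
  finally have d: "norm (L_one p \<chi> - L_trunc \<chi>) \<le> 2 / real p" .
  have "norm (L_trunc \<chi>) \<le> (\<Sum>k<p ^ 2. 1 / real (Suc k))"
    unfolding L_trunc_alt
    by (rule sum_norm_le) (auto simp: norm_divide norm_odd_char[OF \<chi>] simp del: of_nat_Suc)
  also have "\<dots> \<le> 1 + ln (real (max (p ^ 2) 1))" by (rule harmonic_le)
  also have "max (p ^ 2) 1 = p ^ 2" using p_gt_2 by (intro max_absorb1 one_le_power) simp
  also have "real (p ^ 2) = real p ^ 2" by (rule of_nat_power)
  also have "ln (real p ^ 2) = 2 * ln (real p)" using p_gt_2 by (simp add: ln_realpow)
  finally have t: "norm (L_trunc \<chi>) \<le> 1 + 2 * ln (real p)" .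
  have "2 / real p \<le> 1" using p_gt_2 by simp
  moreover have "\<bar>cmod (L_one p \<chi>) - cmod (L_trunc \<chi>)\<bar> \<le> 2 / real p"
    using d norm_triangle_ineq3 order_trans by blast
  ultimately have le: "\<bar>cmod (L_one p \<chi>) - cmod (L_trunc \<chi>)\<bar> \<le> 2 / real p"
    "cmod (L_one p \<chi>) \<le> 3 + 2 * ln (real p)" "cmod (L_trunc \<chi>) \<le> 3 + 2 * ln (real p)"
    using t by auto
  have "\<bar>cmod (L_one p \<chi>) ^ 4 - cmod (L_trunc \<chi>) ^ 4\<bar>
      \<le> 4 * (3 + 2 * ln (real p)) ^ 3 * \<bar>cmod (L_one p \<chi>) - cmod (L_trunc \<chi>)\<bar>"
    by (rule abs_power4_diff_le) (use le in auto)
  also have "\<dots> \<le> 4 * (3 + 2 * ln (real p)) ^ 3 * (2 / real p)"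
    using le(1) p_gt_2 by (intro mult_left_mono) auto
  finally show ?thesis by (simp add: mult_ac)
qed

end

section \<open>The fourth moment\<close>

text \<open>These are the coefficients of the square of a Dirichlet polynomial of length
  \<open>N\<close>; they agree with the divisor count up to \<open>N\<close> and never exceed it at
  positive arguments.\<close>

definition trunc_divisor_count :: "nat \<Rightarrow> nat \<Rightarrow> nat" where
  "trunc_divisor_count N n = card {(x, y). x \<in> {1..N} \<and> y \<in> {1..N} \<and> x * y = n}"

lemma trunc_divisor_count_le: "n > 0 \<Longrightarrow> trunc_divisor_count N n \<le> divisor_count n"
proof -
  assume n: "n > 0"
  let ?A = "{(x, y). x \<in> {1..N} \<and> y \<in> {1..N} \<and> x * y = n}"
  have "card ?A = card (fst ` ?A)"
    by (rule card_image[symmetric]) (auto simp: inj_on_def)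
  also have "\<dots> \<le> card {k. k dvd n}" using n by (intro card_mono) auto
  finally show ?thesis by (simp add: trunc_divisor_count_def divisor_count_def)
qed

lemma trunc_divisor_count_eq:
  assumes "n > 0" "n \<le> N"
  shows "trunc_divisor_count N n = divisor_count n"
proof -
  let ?A = "{(x, y). x \<in> {1..N} \<and> y \<in> {1..N} \<and> x * y = n}"
  have "{k. k dvd n} = fst ` ?A"
  proof (intro equalityI subsetI)
    fix k assume "k \<in> {k. k dvd n}"
    then obtain j where j: "n = k * j" by auto
    hence "k \<ge> 1" "j \<ge> 1" using assms by (auto simp: Suc_le_eq)
    moreover have "k \<le> n" "j \<le> n" using j assms(1) by (auto intro: dvd_imp_le)
    hence "k \<le> N" "j \<le> N" using assms(2) by simp_all
    ultimately have "(k, j) \<in> ?A" using j assms(2) by simp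
    thus "k \<in> fst ` ?A" by force
  qed auto
  moreover have "card (fst ` ?A) = card ?A"
    by (rule card_image) (auto simp: inj_on_def)
  ultimately show ?thesis by (simp add: trunc_divisor_count_def divisor_count_def)
qed

lemma square_sum_eq:
  fixes F :: "nat \<Rightarrow> complex"
  assumes mult: "\<And>x y. F (x * y) = F x * F y"
  shows "(\<Sum>n\<in>{1..N}. F n) ^ 2 = (\<Sum>n\<in>{1..N ^ 2}. of_nat (trunc_divisor_count N n) * F n)"
proof -
  let ?P = "{1..N} \<times> {1..N}"
  have "(\<Sum>n\<in>{1..N}. F n) ^ 2 = (\<Sum>z\<in>?P. F (fst z * snd z))"
    by (simp add: power2_eq_square sum_product mult sum.cartesian_product case_prod_beta)
  also have "\<dots> = (\<Sum>n\<in>{1..N ^ 2}. \<Sum>z\<in>{z \<in> ?P. fst z * snd z = n}. F (fst z * snd z))"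
  proof (rule sum.group[symmetric])
    show "(\<lambda>z. fst z * snd z) ` ?P \<subseteq> {1..N ^ 2}"
    proof (rule image_subsetI)
      fix z assume z: "z \<in> ?P"
      hence "fst z * snd z \<le> N * N" by (intro mult_le_mono) auto
      thus "fst z * snd z \<in> {1..N ^ 2}" using z by (auto simp: power2_eq_square Suc_le_eq)
    qed
  qed auto
  also have "\<dots> = (\<Sum>n\<in>{1..N ^ 2}. of_nat (trunc_divisor_count N n) * F n)"
  proof (rule sum.cong[OF refl])
    fix n
    have "{z \<in> ?P. fst z * snd z = n} = {(x, y). x \<in> {1..N} \<and> y \<in> {1..N} \<and> x * y = n}" by auto
    moreover have "(\<Sum>z\<in>{z \<in> ?P. fst z * snd z = n}. F (fst z * snd z)) = (\<Sum>z\<in>{z \<in> ?P. fst z * snd z = n}. F n)"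
      by (rule sum.cong) auto
    ultimately show "(\<Sum>z\<in>{z \<in> ?P. fst z * snd z = n}. F (fst z * snd z)) = of_nat (trunc_divisor_count N n) * F n"
      by (simp add: trunc_divisor_count_def)
  qed
  finally show ?thesis .
qed

section \<open>The truncated moment as a double sum, and its diagonal\<close>

context odd_order_subgroup
begin

lemma odd_char_mult:
  assumes \<chi>: "\<chi> \<in> odd_chars_trivial p m"
  shows "\<chi> (int (x * y) mod int p) = \<chi> (int x mod int p) * \<chi> (int y mod int p)"
proof (cases "p dvd x \<or> p dvd y")
  case True
  hence "p dvd x * y" by auto
  thus ?thesis using True odd_char_dvd[OF \<chi>] by auto
next
  case False
  have "int n mod int p \<in> {1..int p - 1}" if "\<not> p dvd n" for n
  proof -
    have "n mod p > 0" "n mod p < p" using that p_gt_2 by (auto simp: mod_greater_zero_iff_not_dvd)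
    thus ?thesis by (simp flip: zmod_int)
  qed
  hence "\<chi> ((int x mod int p) * (int y mod int p) mod int p) = \<chi> (int x mod int p) * \<chi> (int y mod int p)"
    using False \<chi> by (intro hom_mult(1)) (auto simp: mem_odd_chars)
  thus ?thesis by (simp add: mod_mult_eq)
qed

text \<open>There are m / 2 odd characters, so this is an average over them, with value 1 on the
  diagonal away from multiples of \<open>p\<close>.\<close>

definition char_corr :: "nat \<Rightarrow> nat \<Rightarrow> complex" where
  "char_corr a b = 2 / of_nat m * (\<Sum>\<chi>\<in>odd_chars_trivial p m. \<chi> (int a mod int p) * cnj (\<chi> (int b mod int p)))"

lemma two_card_over_m: "2 / of_nat m * (of_nat (card (odd_chars_trivial p m)) :: complex) = 1"
proof -
  have "of_nat m = (2 * of_nat (card (odd_chars_trivial p m)) :: complex)"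
    by (metis card_odd_chars of_nat_mult of_nat_numeral)
  moreover have "of_nat m \<noteq> (0::complex)" using m_pos by simp
  ultimately show ?thesis by (simp add: field_simps)
qed

lemma two_card_over_m_real: "2 / real m * real (card (odd_chars_trivial p m)) = 1"
proof -
  have "real m = 2 * real (card (odd_chars_trivial p m))"
    by (metis card_odd_chars of_nat_mult of_nat_numeral)
  moreover have "real m \<noteq> 0" using m_pos by simp
  ultimately show ?thesis by (simp add: field_simps)
qed

lemma char_corr_diag: "char_corr a a = (if p dvd a then 0 else 1)"
proof -
  have "(\<Sum>\<chi>\<in>odd_chars_trivial p m. \<chi> (int a mod int p) * cnj (\<chi> (int a mod int p)))
      = (\<Sum>\<chi>\<in>odd_chars_trivial p m. if p dvd a then 0 else 1)"
    by (rule sum.cong[OF refl]) (simp add: norm_odd_char complex_norm_square[symmetric])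
  thus ?thesis using two_card_over_m by (simp add: char_corr_def)
qed

lemma norm_char_corr_le: "norm (char_corr a b) \<le> 1"
proof -
  have "norm (char_corr a b) \<le> 2 / real m * (\<Sum>\<chi>\<in>odd_chars_trivial p m. 1)"
    unfolding char_corr_def norm_mult
    by (intro mult_mono sum_norm_le) (auto simp: norm_mult norm_odd_char norm_divide)
  thus ?thesis using two_card_over_m_real by simp
qed

lemma char_corr_eq_0:
  assumes "p dvd a \<or> p dvd b \<or> \<not> [a ^ (2 * d) = b ^ (2 * d)] (mod p)"
  shows "char_corr a b = 0"
proof (cases "p dvd a \<or> p dvd b")
  case True
  have "(\<Sum>\<chi>\<in>odd_chars_trivial p m. \<chi> (int a mod int p) * cnj (\<chi> (int b mod int p))) = (\<Sum>\<chi>\<in>odd_chars_trivial p m. 0)"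
  proof (intro sum.cong refl)
    fix \<chi> assume \<chi>: "\<chi> \<in> odd_chars_trivial p m"
    have "\<chi> (int a mod int p) = 0 \<or> \<chi> (int b mod int p) = 0"
      using True odd_char_dvd[OF \<chi>] by blast
    thus "\<chi> (int a mod int p) * cnj (\<chi> (int b mod int p)) = 0" by auto
  qed
  thus ?thesis by (simp add: char_corr_def)
next
  case False
  thus ?thesis using assms odd_chars_orthogonal[of a b] by (simp add: char_corr_def)
qed

definition trunc_coeff :: "nat \<Rightarrow> real" where
  "trunc_coeff n = real (trunc_divisor_count (p ^ 2) n) / real n"

definition L_trunc_moment :: real where
  "L_trunc_moment = 2 / real m * (\<Sum>\<chi>\<in>odd_chars_trivial p m. cmod (L_trunc \<chi>) ^ 4)"

lemma L_trunc_square: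
  assumes \<chi>: "\<chi> \<in> odd_chars_trivial p m"
  shows "L_trunc \<chi> ^ 2 = (\<Sum>n\<in>{1..p ^ 4}. of_real (trunc_coeff n) * \<chi> (int n mod int p))"
proof -
  have "L_trunc \<chi> ^ 2 = (\<Sum>n\<in>{1..(p ^ 2) ^ 2}. of_nat (trunc_divisor_count (p ^ 2) n) * (\<chi> (int n mod int p) / of_nat n))"
    unfolding L_trunc_def by (rule square_sum_eq, simp only: odd_char_mult[OF \<chi>]) simp
  also have "(p ^ 2) ^ 2 = p ^ 4" unfolding power_mult[symmetric] by simp
  finally show ?thesis by (simp add: trunc_coeff_def)
qed

text \<open>Writing the fourth power of the norm as S^2 times its conjugate leaves two indices in
  place of four, with divisor coefficients. The identity is stated over the complex numbers because
  of the conjugates.\<close>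

lemma L_trunc_moment_eq:
  "complex_of_real L_trunc_moment =
     (\<Sum>(a, b)\<in>{1..p ^ 4} \<times> {1..p ^ 4}. of_real (trunc_coeff a * trunc_coeff b) * char_corr a b)"
proof -
  let ?I = "{1..p ^ 4}" and ?X = "odd_chars_trivial p m"
  have four: "complex_of_real (cmod (L_trunc \<chi>) ^ 4) =
    (\<Sum>(a, b)\<in>?I \<times> ?I. of_real (trunc_coeff a * trunc_coeff b) * (\<chi> (int a mod int p) * cnj (\<chi> (int b mod int p))))"
    if \<chi>: "\<chi> \<in> ?X" for \<chi>
  proof -
    have "cmod (L_trunc \<chi>) ^ 4 = cmod (L_trunc \<chi> ^ 2) ^ 2" unfolding norm_power power_mult[symmetric] by simp
    hence "complex_of_real (cmod (L_trunc \<chi>) ^ 4) = L_trunc \<chi> ^ 2 * cnj (L_trunc \<chi> ^ 2)"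
      by (simp only: complex_norm_square)
    also have "\<dots> = (\<Sum>a\<in>?I. \<Sum>b\<in>?I. (of_real (trunc_coeff a) * \<chi> (int a mod int p)) * cnj (of_real (trunc_coeff b) * \<chi> (int b mod int p)))"
      unfolding L_trunc_square[OF \<chi>] cnj_sum sum_product ..
    also have "\<dots> = (\<Sum>a\<in>?I. \<Sum>b\<in>?I. of_real (trunc_coeff a * trunc_coeff b) * (\<chi> (int a mod int p) * cnj (\<chi> (int b mod int p))))"
      by (intro sum.cong refl) (simp add: mult_ac)
    finally show ?thesis by (simp only: sum.cartesian_product)
  qed
  have "complex_of_real L_trunc_moment = 2 / of_nat m * (\<Sum>\<chi>\<in>?X. complex_of_real (cmod (L_trunc \<chi>) ^ 4))"
    unfolding L_trunc_moment_def of_real_mult of_real_sum of_real_divide by simp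
  also have "(\<Sum>\<chi>\<in>?X. complex_of_real (cmod (L_trunc \<chi>) ^ 4)) =
    (\<Sum>\<chi>\<in>?X. \<Sum>(a, b)\<in>?I \<times> ?I. of_real (trunc_coeff a * trunc_coeff b) * (\<chi> (int a mod int p) * cnj (\<chi> (int b mod int p))))"
    proof (rule sum.cong[OF refl])
    fix \<chi> assume "\<chi> \<in> ?X"
    thus "complex_of_real (cmod (L_trunc \<chi>) ^ 4) =
      (\<Sum>(a, b)\<in>?I \<times> ?I. of_real (trunc_coeff a * trunc_coeff b) * (\<chi> (int a mod int p) * cnj (\<chi> (int b mod int p))))"
      by (rule four)
  qed
  also have "\<dots> = (\<Sum>(a, b)\<in>?I \<times> ?I. of_real (trunc_coeff a * trunc_coeff b) * (\<Sum>\<chi>\<in>?X. \<chi> (int a mod int p) * cnj (\<chi> (int b mod int p))))"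
    by (rule trans[OF sum.swap]) (simp only: case_prod_unfold sum_distrib_left)
  also have "2 / of_nat m * \<dots> = (\<Sum>(a, b)\<in>?I \<times> ?I. 2 / of_nat m * (of_real (trunc_coeff a * trunc_coeff b) * (\<Sum>\<chi>\<in>?X. \<chi> (int a mod int p) * cnj (\<chi> (int b mod int p)))))"
    by (simp only: sum_distrib_left case_prod_unfold)
  also have "\<dots> = (\<Sum>(a, b)\<in>?I \<times> ?I. of_real (trunc_coeff a * trunc_coeff b) * char_corr a b)"
    by (intro sum.cong refl) (simp add: char_corr_def case_prod_beta)
  finally show ?thesis .
qed

lemma L_trunc_moment_offdiag:
  "\<bar>L_trunc_moment - (\<Sum>a\<in>{1..p ^ 4}. if p dvd a then 0 else trunc_coeff a ^ 2)\<bar>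
     \<le> (\<Sum>(a, b)\<in>cong_pairs p (2 * d) (p ^ 4). (real (divisor_count a) / real a) * (real (divisor_count b) / real b))"
proof -
  let ?I = "{1..p ^ 4}"
  define C where "C = cong_pairs p (2 * d) (p ^ 4)"
  define G where "G = (\<lambda>(a, b). of_real (trunc_coeff a * trunc_coeff b) * char_corr a b)"
  define \<Delta> where "\<Delta> = (\<lambda>a. (a, a)) ` ?I"
  have coeff: "0 \<le> trunc_coeff n" "n \<ge> 1 \<Longrightarrow> trunc_coeff n \<le> real (divisor_count n) / real n" for n
    using trunc_divisor_count_le[of n] by (auto simp: trunc_coeff_def intro!: divide_right_mono)
  have sub: "C \<subseteq> ?I \<times> ?I - \<Delta>" by (auto simp: C_def \<Delta>_def cong_pairs_def)
  have \<Delta>: "\<Delta> \<subseteq> ?I \<times> ?I" by (auto simp: \<Delta>_def)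
  have "complex_of_real L_trunc_moment = sum G (?I \<times> ?I)" unfolding L_trunc_moment_eq G_def ..
  also have "\<dots> = sum G (?I \<times> ?I - \<Delta>) + sum G \<Delta>" by (rule sum.subset_diff[OF \<Delta>]) simp
  also have "sum G (?I \<times> ?I - \<Delta>) = sum G C"
  proof (rule sum.mono_neutral_right[OF _ sub])
    show "\<forall>x\<in>?I \<times> ?I - \<Delta> - C. G x = 0"
    proof (rule ballI, clarify)
      fix a b assume "a \<in> ?I" "b \<in> ?I" "(a, b) \<notin> \<Delta>" "(a, b) \<notin> C"
      hence "p dvd a \<or> p dvd b \<or> \<not> [a ^ (2 * d) = b ^ (2 * d)] (mod p)"
        by (auto simp: C_def \<Delta>_def cong_pairs_def)
      thus "G (a, b) = 0" using char_corr_eq_0[of a b] by (simp add: G_def)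
    qed
  qed simp
  also have "sum G \<Delta> = (\<Sum>a\<in>?I. G (a, a))"
    unfolding \<Delta>_def by (subst sum.reindex) (auto simp: inj_on_def)
  also have "\<dots> = of_real (\<Sum>a\<in>?I. if p dvd a then 0 else trunc_coeff a ^ 2)"
    unfolding of_real_sum by (intro sum.cong refl) (simp add: G_def char_corr_diag power2_eq_square)
  finally have "complex_of_real (L_trunc_moment - (\<Sum>a\<in>?I. if p dvd a then 0 else trunc_coeff a ^ 2)) = sum G C"
    by (simp only: of_real_diff) simp
  hence "\<bar>L_trunc_moment - (\<Sum>a\<in>?I. if p dvd a then 0 else trunc_coeff a ^ 2)\<bar> = norm (sum G C)"
    by (metis norm_of_real)
  also have "\<dots> \<le> (\<Sum>(a, b)\<in>C. (real (divisor_count a) / real a) * (real (divisor_count b) / real b))"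
  proof (rule sum_norm_le, clarify)
    fix a b assume ab: "(a, b) \<in> C"
    hence ab1: "a \<ge> 1" "b \<ge> 1" by (auto simp: C_def cong_pairs_def)
    have "norm (G (a, b)) = trunc_coeff a * trunc_coeff b * norm (char_corr a b)"
      using coeff(1)[of a] coeff(1)[of b] by (simp add: G_def norm_mult)
    also have "\<dots> \<le> (real (divisor_count a) / real a) * (real (divisor_count b) / real b) * 1"
      using coeff(1)[of a] coeff(1)[of b] coeff(2)[OF ab1(1)] coeff(2)[OF ab1(2)] norm_char_corr_le[of a b]
      by (intro mult_mono) auto
    finally show "norm (G (a, b)) \<le> (real (divisor_count a) / real a) * (real (divisor_count b) / real b)"
      by simp
  qed
  finally show ?thesis by (simp add: C_def)
qed

lemma L_moment_trunc:
  "\<bar>L_moment 4 p m - L_trunc_moment\<bar> \<le> 8 / real p * (3 + 2 * ln (real p)) ^ 3"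
proof -
  let ?X = "odd_chars_trivial p m"
  have "\<bar>L_moment 4 p m - L_trunc_moment\<bar> = 2 / real m * \<bar>\<Sum>\<chi>\<in>?X. cmod (L_one p \<chi>) ^ 4 - cmod (L_trunc \<chi>) ^ 4\<bar>"
  proof -
    have "L_moment 4 p m - L_trunc_moment = 2 / real m * (\<Sum>\<chi>\<in>?X. cmod (L_one p \<chi>) ^ 4 - cmod (L_trunc \<chi>) ^ 4)"
      unfolding L_moment_def L_trunc_moment_def by (simp only: sum_subtractf right_diff_distrib)
    thus ?thesis by (simp add: abs_mult)
  qed
  also have "\<dots> \<le> 2 / real m * (\<Sum>\<chi>\<in>?X. 8 / real p * (3 + 2 * ln (real p)) ^ 3)"
    by (intro mult_left_mono order_trans[OF sum_abs] sum_mono L_one_trunc) auto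
  also have "\<dots> = (2 / real m * real (card ?X)) * (8 / real p * (3 + 2 * ln (real p)) ^ 3)" by simp
  finally show ?thesis unfolding two_card_over_m_real by simp
qed

text \<open>For n < p the terms agree exactly: \<open>p\<close> does not divide \<open>n\<close>,
  and the truncated divisor count is complete. For n \<ge> p the factorisation n^(-31/16) = n^(-1/2)
  n^(-23/16) yields p^(-1/2) times a convergent sum.\<close>

lemma diagonal_bound:
  assumes C: "C > 0" "\<And>n. n > 0 \<Longrightarrow> real (divisor_count n) \<le> C * real n powr (1/32)"
  shows "\<bar>(\<Sum>a\<in>{1..p ^ 4}. if p dvd a then 0 else trunc_coeff a ^ 2)
      - (\<Sum>k. real (divisor_count (Suc k)) ^ 2 / real (Suc k) ^ 2)\<bar>
     \<le> C ^ 2 * (\<Sum>n. real n powr (-23/16)) * real p powr (-1/2)"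
proof -
  define e where "e n = (real (divisor_count n) / real n) ^ 2" for n
  \<comment> \<open>Extension by 0 turns the finite diagonal into a series that can be compared with
    the main term termwise.\<close>
  define e' where "e' n = (if n \<in> {1..p ^ 4} \<and> \<not> p dvd n then trunc_coeff n ^ 2 else 0)" for n
  have e_le: "e n \<le> C ^ 2 * real n powr (-31/16)" if "n > 0" for n
  proof -
    have "real (divisor_count n) / real n \<le> C * real n powr (1/32) / real n"
      using C(2)[OF that] by (rule divide_right_mono) simp
    also have "\<dots> = C * (real n powr (1/32) * real n powr (-1))" using that by (simp add: powr_minus_divide)
    also have "\<dots> = C * real n powr (-31/32)" by (simp only: powr_add[symmetric]) simp
    finally have "e n \<le> (C * real n powr (-31/32)) ^ 2" unfolding e_def by (intro power_mono) auto
    also have "\<dots> = C ^ 2 * (real n powr (-31/32)) ^ 2" by (rule power_mult_distrib)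
    also have "(real n powr (-31/32)) ^ 2 = real n powr (-31/16)" using that by (simp add: powr_power)
    finally show ?thesis .
  qed
  have sum31: "summable (\<lambda>k. C ^ 2 * real (Suc k) powr (-31/16))"
    by (intro summable_mult summable_Suc_iff[THEN iffD2] summable_powr_nat) auto
  have e: "summable (\<lambda>k. e (Suc k))"
    by (rule summable_comparison_test'[OF sum31, of 0]) (use e_le in \<open>auto simp: e_def simp del: of_nat_Suc\<close>)
  have e'0: "0 \<le> e' n" for n by (simp add: e'_def)
  have e'_le: "e' n \<le> e n" if "n > 0" for n
    unfolding e'_def e_def trunc_coeff_def using trunc_divisor_count_le[OF that, of "p ^ 2"]
    by (auto intro!: power_mono divide_right_mono)
  have e'_eq: "e' n = e n" if n: "n > 0" "n < p" for n
  proof -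
    have pp: "p \<le> p ^ 2" "p \<le> p ^ 4" using p_gt_2 by (auto intro!: self_le_power)
    have "n \<le> p ^ 2" using n pp by linarith
    moreover have "n \<le> p ^ 4" using n pp by linarith
    moreover have "\<not> p dvd n" using n by (auto dest: dvd_imp_le)
    ultimately show ?thesis using n by (simp add: e'_def e_def trunc_coeff_def trunc_divisor_count_eq)
  qed
  have e': "summable (\<lambda>k. e' (Suc k))"
    by (rule summable_comparison_test'[OF e, of 0]) (use e'_le e'0 in auto)
  have "(\<Sum>k. e' (Suc k)) = (\<Sum>k<p ^ 4. e' (Suc k))"
    by (rule suminf_finite) (auto simp: e'_def)
  also have "\<dots> = (\<Sum>a\<in>{1..p ^ 4}. e' a)"
    by (rule sum.reindex_bij_witness[of _ "\<lambda>n. n - 1" Suc]) auto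
  also have "\<dots> = (\<Sum>a\<in>{1..p ^ 4}. if p dvd a then 0 else trunc_coeff a ^ 2)"
    by (intro sum.cong refl) (simp add: e'_def)
  finally have s': "(\<Sum>k. e' (Suc k)) = (\<Sum>a\<in>{1..p ^ 4}. if p dvd a then 0 else trunc_coeff a ^ 2)" .
  have s: "(\<Sum>k. real (divisor_count (Suc k)) ^ 2 / real (Suc k) ^ 2) = (\<Sum>k. e (Suc k))"
    by (simp add: e_def power_divide)
  have sum23: "summable (\<lambda>k. real (Suc k) powr (-23/16))"
    by (intro summable_Suc_iff[THEN iffD2] summable_powr_nat) auto
  have diff: "e (Suc k) - e' (Suc k) \<le> C ^ 2 * real p powr (-1/2) * real (Suc k) powr (-23/16)" for k
  proof (cases "Suc k < p")
    case True
    thus ?thesis using e'_eq[of "Suc k"] by simp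
  next
    case False
    have "e (Suc k) - e' (Suc k) \<le> C ^ 2 * real (Suc k) powr (-31/16)"
      using e_le[of "Suc k"] e'0[of "Suc k"] by simp
    also have "real (Suc k) powr (-31/16) = real (Suc k) powr (-1/2) * real (Suc k) powr (-23/16)"
      by (simp only: powr_add[symmetric]) simp
    also have "C ^ 2 * \<dots> \<le> C ^ 2 * (real p powr (-1/2) * real (Suc k) powr (-23/16))"
      using False p_gt_2 by (intro mult_left_mono mult_right_mono powr_mono2') auto
    finally show ?thesis by (simp add: mult_ac)
  qed
  have "\<bar>(\<Sum>k. e' (Suc k)) - (\<Sum>k. e (Suc k))\<bar> = (\<Sum>k. e (Suc k) - e' (Suc k))"
  proof -
    have "(\<Sum>k. e (Suc k) - e' (Suc k)) = (\<Sum>k. e (Suc k)) - (\<Sum>k. e' (Suc k))"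
      by (rule suminf_diff[OF e e', symmetric])
    moreover have "(\<Sum>k. e (Suc k) - e' (Suc k)) \<ge> 0"
      by (intro suminf_nonneg summable_diff e e') (use e'_le in auto)
    ultimately show ?thesis by simp
  qed
  also have "\<dots> \<le> (\<Sum>k. C ^ 2 * real p powr (-1/2) * real (Suc k) powr (-23/16))"
    by (intro suminf_le summable_diff e e' summable_mult sum23 diff)
  also have "\<dots> = C ^ 2 * real p powr (-1/2) * (\<Sum>k. real (Suc k) powr (-23/16))"
    by (rule suminf_mult[OF sum23])
  \<comment> \<open>The term at n = 0 is harmless, since 0 raised by \<open>powr\<close> is
    0.\<close>
  also have "(\<Sum>k. real (Suc k) powr (-23/16)) = (\<Sum>n. real n powr (-23/16))"
    using suminf_split_head[OF summable_powr_nat[of "-23/16"]] by simp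
  finally show ?thesis unfolding s s' by (simp add: mult_ac)
qed

end

text \<open>The constant is fixed before \<open>p\<close>, \<open>m\<close> and \<open>d\<close>,
  which is what the asymptotic statement requires. Its summands come from truncating the series,
  from the off-diagonal pairs and from the diagonal.\<close>

lemma L_moment_4_bound:
  obtains K where "\<And>p m d. prime p \<Longrightarrow> p > 2 \<Longrightarrow> p - 1 = d * m \<Longrightarrow> odd d \<Longrightarrow> real (totient d) \<le> ln (real p) \<Longrightarrow>
    \<bar>L_moment 4 p m - (\<Sum>k. real (divisor_count (Suc k)) ^ 2 / real (Suc k) ^ 2)\<bar>
      \<le> K * real p powr (-1 / (4 * real (totient d)))"
proof -
  obtain C where C: "C > 0" "\<And>n. n > 0 \<Longrightarrow> real (divisor_count n) \<le> C * real n powr (1/32)"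
    using divisor_count_bound[of "1/32"] by auto
  define z1 where "z1 = (\<Sum>n. real n powr (-31/16))"
  define z2 where "z2 = (\<Sum>n. real n powr (-21/16))"
  define z3 where "z3 = (\<Sum>n. real n powr (-23/16))"
  define K1 where "K1 = C ^ 2 * (2 * z1 * (8 + 4 * 256 ^ 8 * z2 + 409600))"
  show ?thesis
  proof (rule that[of "8 * 11 ^ 3 * 4 ^ 3 + (K1 + C ^ 2 * z3)"])
    fix p m d :: nat
    assume p: "prime p" "p > 2" and pd: "p - 1 = d * m" and d: "odd d" and le: "real (totient d) \<le> ln (real p)"
    interpret odd_order_subgroup p m d by unfold_locales (use p pd d in auto)
    define \<theta> where "\<theta> = real p powr (-1 / (4 * real (totient d)))"
    have z: "z1 \<ge> 0" "z2 \<ge> 0" "z3 \<ge> 0"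
    proof -
      have "0 \<le> (\<Sum>n. real n powr s)" if "s < -1" for s
        by (intro suminf_nonneg summable_powr_nat that) auto
      thus "z1 \<ge> 0" "z2 \<ge> 0" "z3 \<ge> 0" unfolding z1_def z2_def z3_def by simp_all
    qed
    have t1: "real (totient d) \<ge> 1" using d_pos by (simp add: Suc_leI)
    have p1: "real p \<ge> 1" using p by simp
    \<comment> \<open>Since totient d \<ge> 1, the error \<theta> is never smaller than p^(-1/4), so
      power savings of at least 1/4 in \<open>p\<close> itself are absorbed.\<close>
    have \<theta>: "real p powr s \<le> \<theta>" if "s \<le> -1/4" for s
    proof -
      have "1 / (4 * real (totient d)) \<le> 1 / 4" using t1 by (intro frac_le) auto
      thus ?thesis unfolding \<theta>_def using that p1 by (intro powr_mono) auto
    qed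
    have "\<bar>L_moment 4 p m - L_trunc_moment\<bar> \<le> 8 / real p * (3 + 2 * ln (real p)) ^ 3"
      by (rule L_moment_trunc)
    \<comment> \<open>The cube of the logarithm is allowed to cost p^(3/4) out of the factor 1 /
      p.\<close>
    also have "\<dots> \<le> 8 / real p * (11 * (4 * real p powr (1/4))) ^ 3"
    proof (intro mult_left_mono power_mono)
      have "ln (real p) \<le> real p powr (1/4) / (1/4)" using ln_powr_bound[of "real p" "1/4"] p1 by simp
      moreover have "1 \<le> real p powr (1/4)" using p1 by (simp add: ge_one_powr_ge_zero)
      ultimately show "3 + 2 * ln (real p) \<le> 11 * (4 * real p powr (1/4))" by simp
    qed (use p1 in auto)
    also have "\<dots> = 8 * 11 ^ 3 * 4 ^ 3 * ((real p powr (1/4)) ^ 3 / real p)" by (simp add: power_mult_distrib)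
    also have "(real p powr (1/4)) ^ 3 / real p = real p powr (3/4) * real p powr (-1)"
      using p1 by (simp add: powr_power powr_minus_divide)
    also have "\<dots> = real p powr (-1/4)" by (simp only: powr_add[symmetric]) simp
    also have "8 * 11 ^ 3 * 4 ^ 3 * real p powr (-1/4) \<le> 8 * 11 ^ 3 * 4 ^ 3 * \<theta>" using \<theta>[of "-1/4"] by simp
    finally have 1: "\<bar>L_moment 4 p m - L_trunc_moment\<bar> \<le> 8 * 11 ^ 3 * 4 ^ 3 * \<theta>" .
    have frac: "real (divisor_count n) / real n \<le> C * wt n" if "n > 0" for n
    proof -
      have "real (divisor_count n) / real n \<le> C * real n powr (1/32) / real n"
        using C(2)[OF that] by (rule divide_right_mono) simp
      also have "\<dots> = C * (real n powr (1/32) * real n powr (-1))" using that by (simp add: powr_minus_divide)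
      also have "\<dots> = C * wt n" by (simp only: powr_add[symmetric]) simp
      finally show ?thesis .
    qed
    have "(\<Sum>(a, b)\<in>cong_pairs p (2 * d) (p ^ 4). (real (divisor_count a) / real a) * (real (divisor_count b) / real b))
        \<le> (\<Sum>(a, b)\<in>cong_pairs p (2 * d) (p ^ 4). C ^ 2 * (wt a * wt b))"
    proof (rule sum_mono, clarify)
      fix a b assume "(a, b) \<in> cong_pairs p (2 * d) (p ^ 4)"
      hence "a > 0" "b > 0" by (auto simp: cong_pairs_def)
      hence "(real (divisor_count a) / real a) * (real (divisor_count b) / real b) \<le> (C * wt a) * (C * wt b)"
        using C(1) by (intro mult_mono frac) auto
      thus "(real (divisor_count a) / real a) * (real (divisor_count b) / real b) \<le> C ^ 2 * (wt a * wt b)"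
        by (simp add: power2_eq_square mult_ac)
    qed
    also have "\<dots> = C ^ 2 * (\<Sum>(a, b)\<in>cong_pairs p (2 * d) (p ^ 4). wt a * wt b)"
      by (simp only: sum_distrib_left case_prod_unfold)
    also have "\<dots> \<le> C ^ 2 * (2 * z1 * ((8 + 4 * 256 ^ 8 * z2 + 409600) * \<theta>))"
    proof (intro mult_left_mono)
      have "(\<Sum>(a, b)\<in>cong_pairs p (2 * d) (p ^ 4). wt a * wt b)
          \<le> 2 * (\<Sum>t\<in>{1..p ^ 4}. real t powr (-31/16)) * (\<Sum>(u, v)\<in>reduced_pairs p (2 * d) (p ^ 4). wt u * wt v)"
        by (rule sum_cong_pairs_le_reduced[OF p(1)])
      also have "\<dots> \<le> 2 * z1 * ((8 + 4 * 256 ^ 8 * z2 + 409600) * \<theta>)"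
        unfolding z1_def z2_def \<theta>_def
        using z(1) sum_reduced_bound[OF p(1) d le]
        by (intro mult_mono sum_powr_le_suminf) (auto simp: z1_def intro!: sum_nonneg)
      finally show "(\<Sum>(a, b)\<in>cong_pairs p (2 * d) (p ^ 4). wt a * wt b)
          \<le> 2 * z1 * ((8 + 4 * 256 ^ 8 * z2 + 409600) * \<theta>)" .
    qed simp
    also have "\<dots> = K1 * \<theta>" by (simp add: K1_def)
    finally have 2: "\<bar>L_trunc_moment - (\<Sum>a\<in>{1..p ^ 4}. if p dvd a then 0 else trunc_coeff a ^ 2)\<bar> \<le> K1 * \<theta>"
      using L_trunc_moment_offdiag by linarith
    have "C ^ 2 * z3 * real p powr (-1/2) \<le> C ^ 2 * z3 * \<theta>"
      using z \<theta>[of "-1/2"] by (intro mult_left_mono) auto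
    hence 3: "\<bar>(\<Sum>a\<in>{1..p ^ 4}. if p dvd a then 0 else trunc_coeff a ^ 2)
      - (\<Sum>k. real (divisor_count (Suc k)) ^ 2 / real (Suc k) ^ 2)\<bar> \<le> C ^ 2 * z3 * \<theta>"
      using diagonal_bound[OF C] unfolding z3_def by linarith
    have "\<bar>L_moment 4 p m - (\<Sum>k. real (divisor_count (Suc k)) ^ 2 / real (Suc k) ^ 2)\<bar>
      \<le> 8 * 11 ^ 3 * 4 ^ 3 * \<theta> + (K1 * \<theta> + C ^ 2 * z3 * \<theta>)"
      using 1 2 3 by linarith
    also have "\<dots> = (8 * 11 ^ 3 * 4 ^ 3 + (K1 + C ^ 2 * z3)) * \<theta>" by (simp only: distrib_right)
    finally show "\<bar>L_moment 4 p m - (\<Sum>k. real (divisor_count (Suc k)) ^ 2 / real (Suc k) ^ 2)\<bar>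
      \<le> (8 * 11 ^ 3 * 4 ^ 3 + (K1 + C ^ 2 * z3)) * real p powr (-1 / (4 * real (totient d)))"
      unfolding \<theta>_def .
  qed
qed

theorem theorem2p8:
  fixes F :: "'a filter" and p m d :: "'a \<Rightarrow> nat" and c :: real
  assumes "filterlim p at_top F"
    and "\<forall>\<^sub>F i in F. prime (p i)"
    and "\<forall>\<^sub>F i in F. m i dvd p i - 1"
    and "\<And>i. d i = (p i - 1) div m i"
    and "\<forall>\<^sub>F i in F. odd (d i)"
    and "(\<lambda>i. real (totient (d i))) \<in> o[F](\<lambda>i. ln (real (p i)))"
    and "c < 1 / 4"
  shows "(\<lambda>i. L_moment 4 (p i) (m i)
              - (\<Sum>k. real (divisor_count (Suc k)) ^ 2 / real (Suc k) ^ 2))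
           \<in> O[F](\<lambda>i. real (p i) powr (- c / real (totient (d i))))"
proof -
  obtain K where K: "\<And>p m d. prime p \<Longrightarrow> p > 2 \<Longrightarrow> p - 1 = d * m \<Longrightarrow> odd d \<Longrightarrow> real (totient d) \<le> ln (real p) \<Longrightarrow>
    \<bar>L_moment 4 p m - (\<Sum>k. real (divisor_count (Suc k)) ^ 2 / real (Suc k) ^ 2)\<bar>
      \<le> K * real p powr (-1 / (4 * real (totient d)))"
    using L_moment_4_bound by blast
  have p2: "\<forall>\<^sub>F i in F. p i > 2" 
    using assms(1)[unfolded filterlim_at_top, rule_format, of 3] by (rule eventually_mono) simp
  have tot: "\<forall>\<^sub>F i in F. norm (real (totient (d i))) \<le> 1 * norm (ln (real (p i)))"
    by (rule landau_o.smallD[OF assms(6)]) simp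
  show ?thesis
  proof (rule bigoI[of _ "\<bar>K\<bar>"])
    show "\<forall>\<^sub>F i in F. norm (L_moment 4 (p i) (m i) - (\<Sum>k. real (divisor_count (Suc k)) ^ 2 / real (Suc k) ^ 2))
       \<le> \<bar>K\<bar> * norm (real (p i) powr (- c / real (totient (d i))))"
      using p2 tot assms(2,3,5)
    proof eventually_elim
      case (elim i)
      have pd: "p i - 1 = d i * m i" using elim assms(4)[of i] by simp
      have d: "d i > 0" using elim(5) by (rule odd_pos)
      have "real (totient (d i)) \<le> ln (real (p i))" using elim by simp
      hence "norm (L_moment 4 (p i) (m i) - (\<Sum>k. real (divisor_count (Suc k)) ^ 2 / real (Suc k) ^ 2))
        \<le> K * real (p i) powr (-1 / (4 * real (totient (d i))))"
        using K[of "p i" "d i" "m i"] elim pd by simp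
      also have "\<dots> \<le> \<bar>K\<bar> * real (p i) powr (-1 / (4 * real (totient (d i))))"
        by (intro mult_right_mono) auto
      also have "\<dots> \<le> \<bar>K\<bar> * real (p i) powr (- c / real (totient (d i)))"
      \<comment> \<open>As p > 1, \<open>powr\<close> grows with its exponent, so the bound with 1/4
        implies the one for every smaller \<open>c\<close>, negative ones included.\<close>
      proof (intro mult_left_mono powr_mono)
        have "c / real (totient (d i)) \<le> (1 / 4) / real (totient (d i))"
          using assms(7) by (intro divide_right_mono) auto
        thus "-1 / (4 * real (totient (d i))) \<le> - c / real (totient (d i))" by simp
      qed (use elim in auto)
      finally show ?case by simp
    qed
  qed
qed

end
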